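(* Let $\{X_i; i\ge 1\}$ be a sequence of independent real-valued random variables with distribution functions $F_i$, let $\{Y_i; i\ge 1\}$ be a sequence of positive independent random variables with distribution functions $G_i$, and assume that the sequences $\{X_i\}$ and $\{Y_i\}$ are mutually independent. Let $\overline F_i=1-F_i$ and $\overline G_i=1-G_i$. Suppose there are positive constants $\alpha,\gamma^*$ and, for every $i\ge1$, a positive constant $\gamma_i$ and slowly varying functions $\ell_i^*(\cdot),\ell_i(\cdot)$ such that, as $x\to\infty$, $$\overline F_i(x)\sim \ell_i^*(\ln x)(\ln x)^{\gamma^*-1}x^{-\alpha},\qquad \overline G_i(x)\sim \ell_i(\ln x)(\ln x)^{\gamma_i-1}x^{-\alpha}.$$ Put $S_0=0$, $S_n=\sum_{i=1}^nX_i\prod_{j=1}^iY_j$ and $M_n=\max_{0\le k\le n}S_k$. Then for every $n\ge1$, with $\bar\gamma_n=\gamma^*+\sum_{i=1}^n\gamma_i$, as $x\to\infty$, $$\mathbb P(S_n>x)\sim\mathbb P(M_n>x)\sim\mathbb P\Big(X_n\prod_{j=1}^nY_j>x\Big)\sim\frac{\alpha^n\,\Gamma(\gamma^* )\prod_{i=1}^n\Gamma(\gamma_i)}{\Gamma(\bar\gamma_n)}\,\ell_n^*(\ln x)\Big(\prod_{i=1}^n\ell_i(\ln x)\Big)(\ln x)^{\bar\gamma_n-1}x^{-\alpha}.$$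
   Context: For two positive functions $a,b$, $a(x)\sim b(x)$ means $\lim_{x\to\infty}a(x)/b(x)=1$. A positive function $\ell$ is slowly varying if $\lim_{x\to\infty}\ell(xy)/\ell(x)=1$ for every $y>0$. $\Gamma$ is the Gamma function. *)

theory Defs
  imports "HOL-Probability.Probability" "HOL-Library.Landau_Symbols"
begin

text \<open>
  The relation \<open>f \<sim>[at_top] g\<close> of the library coincides with \<open>f x / g x \<longlongrightarrow> 1\<close> whenever
  \<open>g\<close> is eventually nonzero. This is the case for explicit right-hand sides such as
  \<open>l (ln x) * ln x powr (\<gamma> - 1) * x powr - \<alpha>\<close> with \<open>l\<close> slowly varying, since \<open>l\<close> is positive
  on the positive half-line, and hence also for every function asymptotically equivalent to one.
\<close>

text \<open>
  A slowly varying function lives on the positive half-line; its values at nonpositive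
  arguments are irrelevant. As usual in the probabilistic literature on asymptotics,
  only positivity and the limit condition are required, not measurability.
\<close>

definition slowly_varying :: "(real \<Rightarrow> real) \<Rightarrow> bool" where
  "slowly_varying l \<longleftrightarrow>
     (\<forall>x>0. l x > 0) \<and> (\<forall>y>0. ((\<lambda>x. l (x * y) / l x) \<longlongrightarrow> 1) at_top)"

definition partial_sum ::
  "(nat \<Rightarrow> 'a \<Rightarrow> real) \<Rightarrow> (nat \<Rightarrow> 'a \<Rightarrow> real) \<Rightarrow> nat \<Rightarrow> 'a \<Rightarrow> real" where
  "partial_sum X Y n \<omega> = (\<Sum>i=1..n. X i \<omega> * (\<Prod>j=1..i. Y j \<omega>))"

definition partial_max ::
  "(nat \<Rightarrow> 'a \<Rightarrow> real) \<Rightarrow> (nat \<Rightarrow> 'a \<Rightarrow> real) \<Rightarrow> nat \<Rightarrow> 'a \<Rightarrow> real" where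
  "partial_max X Y n \<omega> = Max ((\<lambda>k. partial_sum X Y k \<omega>) ` {0..n})"

text \<open>
  Sequences are indexed from 1, so the value at index 0 plays no role. Mutual independence
  of the two sequences is independence of the two random elements of \<open>\<real>\<^sup>\<infinity>\<close> they form,
  with respect to the product sigma-algebra.
\<close>

definition (in prob_space) independent_sequences ::
  "(nat \<Rightarrow> 'a \<Rightarrow> real) \<Rightarrow> (nat \<Rightarrow> 'a \<Rightarrow> real) \<Rightarrow> bool" where
  "independent_sequences X Y \<longleftrightarrow>
     indep_var (Pi\<^sub>M {1..} (\<lambda>_. borel)) (\<lambda>\<omega>. \<lambda>i\<in>{1..}. X i \<omega>)
               (Pi\<^sub>M {1..} (\<lambda>_. borel)) (\<lambda>\<omega>. \<lambda>i\<in>{1..}. Y i \<omega>)"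

end

(*
  Substitute x = exp t and write A_U(t) = exp(alpha t) P(U > exp t); a tail hypothesis of the theorem
  says that A_U is asymptotically a regularly varying function of t. If U and V > 0 are independent
  with A_U, A_V of index a - 1 and b - 1, conditioning on ln V = s turns P(U V > exp t) into a
  convolution: A_(UV)(t) ~ alpha * integral of A_U(t - s) A_V(s) ds over [0,t]
  ~ alpha * Beta(a,b) * t * A_U(t) * A_V(t). The weights alpha * Beta(a,b) multiply to the Gamma
  quotient. Since S_n = Y_1 (X_1 + Y_2 (X_2 + ...)), this is applied from the inside outwards; at each
  step the summand X_i has a tail of strictly smaller index in t than the inner sum and is negligible.
  Replacing X by its positive part gives an upper bound for M_n with the same asymptotics.
*)
theory Submission
  imports Defs "HOL-Real_Asymp.Real_Asymp"
begin

text \<open>Only tails are known: ln V has no density, and the slowly varying factors need not be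
  measurable. Regular variation is therefore attributed to the scaled tails themselves. They are
  measurable because a tail is monotone, and measurability is what the uniform convergence theorem
  rests on. The mass of ln V in a window of length h is a difference of two tails. Since A_V(s + h)
  / A_V(s) tends to 1 while exp (- alpha s) drops by the factor exp (- alpha h), that mass is about
  alpha h exp (- alpha s) A_V(s); this is the origin of the factor alpha. The definition compares t
  with t c for fixed c, so the additive shift from s to s + h already needs the uniform version.
  Positivity of the exponents is used three times: the Beta integrals converge, the part of a
  product where one factor stays bounded is negligible, and the inner sum has a tail of strictly
  larger index than the summand added to it.\<close>

section \<open>Regularly varying functions: uniform convergence, Potter bounds, closure
  properties\<close>

definition regularly_varying :: "(real \<Rightarrow> real) \<Rightarrow> real \<Rightarrow> bool" where
  "regularly_varying f r \<longleftrightarrow> f \<in> borel_measurable borel \<and> (\<forall>\<^sub>F t in at_top. f t > 0) \<and>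
     (\<forall>c>0. ((\<lambda>t. f (t * c) / f t) \<longlongrightarrow> c powr r) at_top)"

text \<open>Uniform convergence theorem: for large x, the bad sets of increments at x and at x + u are too
  small to cover the overlap of [x, x + 2] and [x + u, x + u + 2], so a common good point compares k at x and x + u.\<close>

lemma vanishing_increments_uniform:
  fixes k :: "real \<Rightarrow> real"
  assumes meas[measurable]: "k \<in> borel_measurable borel"
    and lim: "\<And>u. u \<ge> 0 \<Longrightarrow> ((\<lambda>x. k (x + u) - k x) \<longlongrightarrow> 0) at_top" and e: "e > 0"
  obtains X where "\<And>x u. x \<ge> X \<Longrightarrow> 0 \<le> u \<Longrightarrow> u \<le> 1 \<Longrightarrow> \<bar>k (x + u) - k x\<bar> < e"
proof -
  define bad where "bad x = {v\<in>{0..2}. e / 2 \<le> \<bar>k (x + v) - k x\<bar>}" for x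
  have bad_meas[measurable]: "bad x \<in> sets borel" for x
    unfolding bad_def by measurable
  have bad_int: "integrable lborel (indicator (bad x) :: real \<Rightarrow> real)" for x
    by (rule Bochner_Integration.integrable_bound[of _ "indicator {0..2}"])
       (auto simp: bad_def indicator_def)
  \<comment> \<open>Each fixed \<open>v\<close> eventually leaves \<open>bad x\<close>; dominated
    convergence on the bounded window turns this pointwise fact into smallness of the measure of
    \<open>bad x\<close>.\<close>
  have "((\<lambda>x. LINT v|lborel. indicator (bad x) v :: real) \<longlongrightarrow> (LINT v|(lborel :: real measure). (0 :: real))) at_top"
  proof (rule integral_dominated_convergence_at_top[where w = "indicator {0..2}"])
    show "AE v in lborel. ((\<lambda>x. indicator (bad x) v :: real) \<longlongrightarrow> 0) at_top"
    proof (rule AE_I2)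
      fix v :: real
      show "((\<lambda>x. indicator (bad x) v :: real) \<longlongrightarrow> 0) at_top"
      proof (cases "v \<in> {0..2}")
        case True
        then have "\<forall>\<^sub>F x in at_top. \<bar>k (x + v) - k x\<bar> < e / 2"
          using tendstoD[OF lim[of v], of "e / 2"] e by (simp add: dist_real_def)
        then have "\<forall>\<^sub>F x in at_top. indicator (bad x) v = (0 :: real)"
          by eventually_elim (auto simp: bad_def)
        then show ?thesis by (rule tendsto_eventually)
      next
        case False
        then have "(\<lambda>x. indicator (bad x) v) = (\<lambda>x. 0 :: real)"
          by (auto simp: bad_def indicator_def fun_eq_iff)
        then show ?thesis by simp
      qed
    qed
  qed (auto simp: bad_def indicator_def)
  \<comment> \<open>The overlap \<open>{u..2}\<close> has length at least 1 when
    \<open>u \<le> 1\<close>, so two bad sets of measure below \<open>1 / 2\<close> each cannot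
    cover it.\<close>
  then have "\<forall>\<^sub>F x in at_top. (LINT v|lborel. indicator (bad x) v :: real) < 1 / 2"
    by (rule order_tendstoD) simp
  then obtain X where X: "\<And>x. x \<ge> X \<Longrightarrow> (LINT v|lborel. indicator (bad x) v :: real) < 1 / 2"
    by (auto simp: eventually_at_top_linorder)
  show thesis
  proof (rule that[of X], rule ccontr)
    fix x u :: real
    assume x: "x \<ge> X" and u: "0 \<le> u" "u \<le> 1" and "\<not> \<bar>k (x + u) - k x\<bar> < e"
    then have far: "\<bar>k (x + u) - k x\<bar> \<ge> e" by simp
    have shift: "(LINT v|lborel. indicator (bad (x + u)) (- u + v)) =
        (LINT v|lborel. indicator (bad (x + u)) v :: real)"
      using lborel_integral_real_affine[of 1 "indicator (bad (x + u)) :: real \<Rightarrow> real" "- u"] by simp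
    have int_shift: "integrable lborel (\<lambda>v. indicator (bad (x + u)) (- u + v) :: real)"
      using lborel_integrable_real_affine[OF bad_int, of 1 "x + u" "- u"] by simp
    have "2 - u = (LINT v|lborel. indicator {u..2} v)"
      using u by simp
    also have "\<dots> \<le> (LINT v|lborel. indicator (bad x) v + indicator (bad (x + u)) (- u + v))"
    proof (rule integral_mono)
      fix v
      show "(indicator {u..2} v :: real) \<le> indicator (bad x) v + indicator (bad (x + u)) (- u + v)"
      proof (cases "v \<in> {u..2}")
        case True
        have "v \<in> bad x \<or> - u + v \<in> bad (x + u)"
        proof (rule ccontr)
          assume "\<not> ?thesis"
          then have "\<bar>k (x + v) - k x\<bar> < e / 2" "\<bar>k (x + v) - k (x + u)\<bar> < e / 2"
            using True u by (auto simp: bad_def)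
          with far show False by linarith
        qed
        with True show ?thesis by (auto simp: indicator_def)
      qed simp
    qed (use int_shift bad_int u in auto)
    also have "\<dots> = (LINT v|lborel. indicator (bad x) v) + (LINT v|lborel. indicator (bad (x + u)) v)"
      using Bochner_Integration.integral_add[OF bad_int int_shift, of x] shift by simp
    finally show False using X[OF x] X[of "x + u"] x u by simp
  qed
qed

text \<open>Unit steps are chained: a distance \<open>\<bar>y - x\<bar>\<close> takes at most
  \<open>\<bar>y - x\<bar> + 1\<close> of them, and each costs less than \<open>e\<close>. The
  summand 1 pays for rounding up.\<close>

lemma vanishing_increments_sublinear:
  fixes k :: "real \<Rightarrow> real"
  assumes "k \<in> borel_measurable borel"
    and "\<And>u. u \<ge> 0 \<Longrightarrow> ((\<lambda>x. k (x + u) - k x) \<longlongrightarrow> 0) at_top" and e: "e > 0"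
  obtains X where "\<And>x y. x \<ge> X \<Longrightarrow> y \<ge> X \<Longrightarrow> \<bar>k y - k x\<bar> \<le> e * (\<bar>y - x\<bar> + 1)"
proof -
  from vanishing_increments_uniform[OF assms] obtain X
    where X: "\<And>x u. x \<ge> X \<Longrightarrow> 0 \<le> u \<Longrightarrow> u \<le> 1 \<Longrightarrow> \<bar>k (x + u) - k x\<bar> < e" by metis
  have steps: "\<bar>k (x + u) - k x\<bar> \<le> e * real m" if "x \<ge> X" "0 \<le> u" "u \<le> real m" for x u m
    using that
  proof (induction m arbitrary: u)
    case (Suc m)
    show ?case
    proof (cases "u \<le> 1")
      case True
      then have "\<bar>k (x + u) - k x\<bar> \<le> e * 1" using X[of x u] Suc.prems by simp
      also have "\<dots> \<le> e * real (Suc m)" using e by (intro mult_left_mono) auto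
      finally show ?thesis .
    next
      case False
      have "\<bar>k (x + (u - 1)) - k x\<bar> \<le> e * real m" using Suc False by simp
      moreover have "\<bar>k (x + (u - 1) + 1) - k (x + (u - 1))\<bar> < e"
        using X[of "x + (u - 1)" 1] Suc.prems False by simp
      moreover have "x + (u - 1) + 1 = x + u" by simp
      ultimately show ?thesis by (simp add: algebra_simps)
    qed
  qed auto
  have up: "\<bar>k y - k x\<bar> \<le> e * (\<bar>y - x\<bar> + 1)" if "x \<ge> X" "x \<le> y" for x y
  proof -
    have "\<bar>k (x + (y - x)) - k x\<bar> \<le> e * real (nat \<lceil>y - x\<rceil>)"
      using that by (intro steps) linarith+
    also have "\<dots> \<le> e * (\<bar>y - x\<bar> + 1)"
      using that e by (intro mult_left_mono) linarith+
    finally show ?thesis by simp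
  qed
  show thesis
  proof (rule that[of X])
    fix x y assume "x \<ge> X" "y \<ge> X"
    then show "\<bar>k y - k x\<bar> \<le> e * (\<bar>y - x\<bar> + 1)"
      using up[of x y] up[of y x] by (cases "x \<le> y") (auto simp: abs_minus_commute)
  qed
qed

lemma regularly_varyingD:
  assumes "regularly_varying f r"
  shows "f \<in> borel_measurable borel" "\<forall>\<^sub>F t in at_top. f t > 0"
    "c > 0 \<Longrightarrow> ((\<lambda>t. f (t * c) / f t) \<longlongrightarrow> c powr r) at_top"
  using assms by (auto simp: regularly_varying_def)

text \<open>On the scale x = ln t, regular variation of index \<open>r\<close> says that
  \<open>ln (f (exp x)) - r * x\<close> has vanishing increments. The sublinear bound on these
  increments is the Potter bound in logarithmic form.\<close>

lemma Potter_bound: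
  assumes rv: "regularly_varying f r" and d: "d > 0"
  obtains T where "T > 0" "\<And>t. t \<ge> T \<Longrightarrow> f t > 0"
    "\<And>s t. s \<ge> T \<Longrightarrow> t \<ge> T \<Longrightarrow> \<bar>ln (f s) - ln (f t) - r * (ln s - ln t)\<bar> \<le> d * (\<bar>ln s - ln t\<bar> + 1)"
proof -
  note [measurable] = regularly_varyingD(1)[OF rv]
  define k where "k x = ln (f (exp x)) - r * x" for x
  have "k \<in> borel_measurable borel" unfolding k_def by measurable
  moreover have "((\<lambda>x. k (x + u) - k x) \<longlongrightarrow> 0) at_top" for u
  proof -
    have "((\<lambda>x. f (exp x * exp u) / f (exp x)) \<longlongrightarrow> exp u powr r) at_top"
      using filterlim_compose[OF regularly_varyingD(3)[OF rv, of "exp u"] exp_at_top] by simp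
    then have lim: "((\<lambda>x. ln (f (exp x * exp u) / f (exp x)) - r * u) \<longlongrightarrow> ln (exp u powr r) - r * u) at_top"
      by (intro tendsto_intros) auto
    have pos: "\<forall>\<^sub>F x in at_top. f (exp x) > 0"
      by (rule eventually_compose_filterlim[OF regularly_varyingD(2)[OF rv] exp_at_top])
    moreover have "\<forall>\<^sub>F x in at_top. f (exp (x + u)) > 0"
      by (rule eventually_compose_filterlim[OF pos])
        (use filterlim_tendsto_add_at_top[OF tendsto_const[of u] filterlim_ident] in \<open>simp add: add.commute\<close>)
    ultimately have "\<forall>\<^sub>F x in at_top. ln (f (exp x * exp u) / f (exp x)) - r * u = k (x + u) - k x"
      by eventually_elim (simp add: k_def ln_div exp_add algebra_simps)
    with lim show ?thesis
      using Lim_transform_eventually by (fastforce simp: ln_powr)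
  qed
  ultimately obtain X where
    X: "\<And>x y. x \<ge> X \<Longrightarrow> y \<ge> X \<Longrightarrow> \<bar>k y - k x\<bar> \<le> d * (\<bar>y - x\<bar> + 1)"
    using vanishing_increments_sublinear[of k d] d by metis
  obtain T0 where T0: "\<And>t. t \<ge> T0 \<Longrightarrow> f t > 0"
    using regularly_varyingD(2)[OF rv] by (auto simp: eventually_at_top_linorder)
  show thesis
  proof (rule that[of "max (exp X) T0"])
    fix s t assume "max (exp X) T0 \<le> s" "max (exp X) T0 \<le> t"
    then have st: "exp X \<le> s" "exp X \<le> t" by auto
    then have "s > 0" "t > 0" using less_le_trans[OF exp_gt_zero] by blast+
    moreover from this st have "X \<le> ln s" "X \<le> ln t" by (simp_all add: ln_ge_iff)
    ultimately show "\<bar>ln (f s) - ln (f t) - r * (ln s - ln t)\<bar> \<le> d * (\<bar>ln s - ln t\<bar> + 1)"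
      using X[of "ln t" "ln s"] by (simp add: k_def algebra_simps)
  qed (use T0 in \<open>auto simp: less_max_iff_disj\<close>)
qed

text \<open>The constant \<open>C\<close> cancels in the ratio of \<open>g\<close> at t c and t.
  Measurability is asked of \<open>g\<close> and not of \<open>f\<close>, because \<open>f\<close>
  will be an explicit expression in a slowly varying function.\<close>

lemma regularly_varying_equivI:
  assumes g: "g \<in> borel_measurable borel" and f: "\<forall>\<^sub>F t in at_top. f t > 0"
    and lim: "\<And>c. c > 0 \<Longrightarrow> ((\<lambda>t. f (t * c) / f t) \<longlongrightarrow> c powr r) at_top"
    and C: "((\<lambda>t. g t / f t) \<longlongrightarrow> C) at_top" "C > 0"
  shows "regularly_varying g r"
  unfolding regularly_varying_def
proof (intro conjI allI impI)
  have g_pos: "\<forall>\<^sub>F t in at_top. g t / f t > 0"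
    using order_tendstoD(1)[OF C] by simp
  then show "\<forall>\<^sub>F t in at_top. g t > 0"
    using f by eventually_elim (auto simp: zero_less_divide_iff)
  fix c :: real assume c: "c > 0"
  have scale: "filterlim (\<lambda>t. t * c) at_top at_top"
    using c by real_asymp
  have "((\<lambda>t. g (t * c) / f (t * c) * (f (t * c) / f t) / (g t / f t)) \<longlongrightarrow> C * c powr r / C) at_top"
    using C by (intro tendsto_intros lim c filterlim_compose[OF C(1) scale]) auto
  moreover have "\<forall>\<^sub>F t in at_top. g (t * c) / f (t * c) * (f (t * c) / f t) / (g t / f t) = g (t * c) / g t"
    using f g_pos eventually_compose_filterlim[OF f scale]
    by eventually_elim (auto simp: field_simps)
  ultimately show "((\<lambda>t. g (t * c) / g t) \<longlongrightarrow> c powr r) at_top"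
    using C(2) by (auto intro: Lim_transform_eventually)
qed (fact g)

lemma regularly_varying_mult:
  assumes "regularly_varying f r" "regularly_varying g s"
  shows "regularly_varying (\<lambda>t. f t * g t) (r + s)"
  unfolding regularly_varying_def
proof (intro conjI allI impI)
  show "(\<lambda>t. f t * g t) \<in> borel_measurable borel"
    using regularly_varyingD(1)[OF assms(1)] regularly_varyingD(1)[OF assms(2)] by measurable
  show "\<forall>\<^sub>F t in at_top. f t * g t > 0"
    using regularly_varyingD(2)[OF assms(1)] regularly_varyingD(2)[OF assms(2)]
    by eventually_elim simp
  show "((\<lambda>t. f (t * c) * g (t * c) / (f t * g t)) \<longlongrightarrow> c powr (r + s)) at_top" if "c > 0" for c
    using tendsto_mult[OF regularly_varyingD(3)[OF assms(1) that] regularly_varyingD(3)[OF assms(2) that]]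
    by (simp add: powr_add)
qed

lemma regularly_varying_inverse:
  assumes "regularly_varying f r"
  shows "regularly_varying (\<lambda>t. inverse (f t)) (- r)"
  unfolding regularly_varying_def
proof (intro conjI allI impI)
  show "(\<lambda>t. inverse (f t)) \<in> borel_measurable borel"
    using regularly_varyingD(1)[OF assms] by measurable
  show "\<forall>\<^sub>F t in at_top. inverse (f t) > 0"
    using regularly_varyingD(2)[OF assms] by eventually_elim simp
  show "((\<lambda>t. inverse (f (t * c)) / inverse (f t)) \<longlongrightarrow> c powr (- r)) at_top" if "c > 0" for c
    using tendsto_inverse[OF regularly_varyingD(3)[OF assms that]] that
    by (simp add: powr_minus field_simps)
qed

lemma regularly_varying_ident: "regularly_varying (\<lambda>t. t) 1"
  unfolding regularly_varying_def
proof (intro conjI allI impI)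
  fix c :: real assume c: "c > 0"
  have "\<forall>\<^sub>F t in at_top. c powr 1 = t * c / t"
    using eventually_gt_at_top[of 0] by eventually_elim (use c in simp)
  then show "((\<lambda>t. t * c / t) \<longlongrightarrow> c powr 1) at_top"
    by (rule Lim_transform_eventually[OF tendsto_const])
qed (auto simp: eventually_gt_at_top)

text \<open>On the logarithmic scale the shift is the increment ln (t + h) - ln t, which tends to 0.
  The factor (t + h) / t varies with t, so convergence at fixed factors does not apply directly; the
  Potter bound controls all factors near 1 at once.\<close>

lemma regularly_varying_shift:
  assumes rv: "regularly_varying f r"
  shows "((\<lambda>t. f (t + h) / f t) \<longlongrightarrow> 1) at_top"
proof -
  have "((\<lambda>t. ln (f (t + h)) - ln (f t)) \<longlongrightarrow> 0) at_top"
  proof (rule tendstoI)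
    fix e :: real assume e: "e > 0"
    obtain T where T: "T > 0" "\<And>s t. s \<ge> T \<Longrightarrow> t \<ge> T \<Longrightarrow>
        \<bar>ln (f s) - ln (f t) - r * (ln s - ln t)\<bar> \<le> e / 4 * (\<bar>ln s - ln t\<bar> + 1)"
      using Potter_bound[OF rv, of "e / 4"] e by (metis zero_less_divide_iff zero_less_numeral)
    \<comment> \<open>An increment of at most 1 keeps the Potter error below \<open>e / 2\<close>,
      and an increment below \<open>\<eta>\<close> keeps the index term below \<open>e / 4\<close>.
      The \<open>+ 1\<close> in the denominator covers \<open>r = 0\<close>.\<close>
    define \<eta> where "\<eta> = min 1 (e / (4 * (\<bar>r\<bar> + 1)))"
    have \<eta>: "\<eta> > 0" "\<eta> \<le> 1" using e by (auto simp: \<eta>_def)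
    have "(\<bar>r\<bar> + 1) * \<eta> \<le> (\<bar>r\<bar> + 1) * (e / (4 * (\<bar>r\<bar> + 1)))"
      by (intro mult_left_mono) (auto simp: \<eta>_def)
    also have "\<dots> = e / 4" by (simp add: field_simps)
    finally have r\<eta>: "\<bar>r\<bar> * \<eta> \<le> e / 4" using \<eta> by (simp add: algebra_simps)
    have "((\<lambda>t. ln (t + h) - ln t) \<longlongrightarrow> 0) at_top" by real_asymp
    from tendstoD[OF this \<eta>(1)] have "\<forall>\<^sub>F t in at_top. \<bar>ln (t + h) - ln t\<bar> < \<eta>"
      by (simp add: dist_real_def)
    moreover have "\<forall>\<^sub>F t in at_top. t \<ge> T" "\<forall>\<^sub>F t in at_top. t \<ge> T - h"
      by (rule eventually_ge_at_top)+
    ultimately show "\<forall>\<^sub>F t in at_top. dist (ln (f (t + h)) - ln (f t)) 0 < e"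
    proof eventually_elim
      case (elim t)
      have "\<bar>ln (f (t + h)) - ln (f t) - r * (ln (t + h) - ln t)\<bar> \<le> e / 4 * (\<bar>ln (t + h) - ln t\<bar> + 1)"
        using elim by (intro T) auto
      also have "\<dots> \<le> e / 4 * (1 + 1)"
        using elim \<eta> e by (intro mult_left_mono add_mono) auto
      finally have "\<bar>ln (f (t + h)) - ln (f t) - r * (ln (t + h) - ln t)\<bar> \<le> e / 2" by simp
      moreover have "\<bar>r * (ln (t + h) - ln t)\<bar> \<le> \<bar>r\<bar> * \<eta>"
        unfolding abs_mult using elim by (intro mult_left_mono) auto
      ultimately show ?case using r\<eta> e unfolding dist_real_def diff_0_right by linarith
    qed
  qed
  then have lim: "((\<lambda>t. exp (ln (f (t + h)) - ln (f t))) \<longlongrightarrow> exp 0) at_top"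
    by (intro tendsto_intros)
  have "filterlim (\<lambda>t. t + h) at_top at_top" by real_asymp
  from eventually_compose_filterlim[OF regularly_varyingD(2)[OF rv] this] regularly_varyingD(2)[OF rv]
  have "\<forall>\<^sub>F t in at_top. exp (ln (f (t + h)) - ln (f t)) = f (t + h) / f t"
    by eventually_elim (simp add: exp_diff)
  with lim show ?thesis
    by (auto intro: Lim_transform_eventually)
qed

text \<open>A Potter bound with slack \<open>- r / 2\<close> gives away only half of the negative
  exponent, so a multiple of \<open>t powr (r / 2)\<close> remains as a majorant. The constant
  \<open>c\<close> collects the terms at the base point \<open>T\<close>.\<close>

lemma regularly_varying_negative_tendsto_0:
  assumes rv: "regularly_varying f r" and r: "r < 0"
  shows "(f \<longlongrightarrow> 0) at_top"
proof -
  obtain T where T: "T > 0" "\<And>t. t \<ge> T \<Longrightarrow> f t > 0" "\<And>s t. s \<ge> T \<Longrightarrow> t \<ge> T \<Longrightarrow>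
      \<bar>ln (f s) - ln (f t) - r * (ln s - ln t)\<bar> \<le> - r / 2 * (\<bar>ln s - ln t\<bar> + 1)"
    using Potter_bound[OF rv, of "- r / 2"] r by (metis divide_pos_pos neg_0_less_iff_less zero_less_numeral)
  define c where "c = ln (f T) - r / 2 * ln T - r / 2"
  have bound: "f t \<le> exp (c + r / 2 * ln t)" if t: "t \<ge> T" for t
  proof -
    have "ln t - ln T \<ge> 0" using t T by simp
    then have "ln (f t) \<le> c + r / 2 * ln t"
      using abs_le_D1[OF T(3)[OF t, of T]] unfolding c_def by (simp add: field_simps)
    then show ?thesis using T(2)[OF t] by (metis exp_le_cancel_iff exp_ln)
  qed
  show ?thesis
  proof (rule tendsto_sandwich[OF _ _ tendsto_const])
    show "\<forall>\<^sub>F t in at_top. 0 \<le> f t"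
      using regularly_varyingD(2)[OF rv] by eventually_elim simp
    show "\<forall>\<^sub>F t in at_top. f t \<le> exp (c + r / 2 * ln t)"
      using eventually_ge_at_top[of T] by eventually_elim (rule bound)
    show "((\<lambda>t. exp (c + r / 2 * ln t)) \<longlongrightarrow> 0) at_top"
      using r by real_asymp
  qed
qed

lemma regularly_varying_ratio_tendsto_0:
  assumes "regularly_varying f r" "regularly_varying g s" "r < s"
  shows "((\<lambda>t. f t / g t) \<longlongrightarrow> 0) at_top"
  using regularly_varying_negative_tendsto_0[OF
      regularly_varying_mult[OF assms(1) regularly_varying_inverse[OF assms(2)]]] assms(3)
  by (simp add: divide_inverse)

text \<open>For \<open>s \<le> t\<close> the difference of logarithms has a known sign, so the slack
  just lowers the exponent to \<open>r - d\<close>. In this form the bound serves as the majorant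
  for dominated convergence.\<close>

lemma Potter_bound_ratio:
  assumes rv: "regularly_varying f r" and d: "d > 0"
  obtains T where "T > 0" "\<And>t. t \<ge> T \<Longrightarrow> f t > 0"
    "\<And>s t. T \<le> s \<Longrightarrow> s \<le> t \<Longrightarrow> f s / f t \<le> exp d * (s / t) powr (r - d)"
proof -
  obtain T where T: "T > 0" "\<And>t. t \<ge> T \<Longrightarrow> f t > 0" "\<And>s t. s \<ge> T \<Longrightarrow> t \<ge> T \<Longrightarrow>
      \<bar>ln (f s) - ln (f t) - r * (ln s - ln t)\<bar> \<le> d * (\<bar>ln s - ln t\<bar> + 1)"
    using Potter_bound[OF rv d] by metis
  have "f s / f t \<le> exp d * (s / t) powr (r - d)" if st: "T \<le> s" "s \<le> t" for s t
  proof -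
    have *: "s > 0" "t > 0" "f s > 0" "f t > 0" using st T(1) T(2)[of s] T(2)[of t] by auto
    then have "ln s \<le> ln t" using st by simp
    then have "ln (f s) - ln (f t) \<le> d + (r - d) * (ln s - ln t)"
      using T(3)[of s t] st by (simp add: algebra_simps)
    then have "exp (ln (f s / f t)) \<le> exp (d + (r - d) * ln (s / t))"
      using * by (simp add: ln_div)
    then show ?thesis using * by (simp add: exp_add powr_def)
  qed
  with T show thesis by (intro that[of T]) auto
qed

section \<open>Beta integrals and convolutions of regularly varying functions\<close>

lemma has_bochner_integral_Beta:
  fixes a b :: real
  assumes "a > 0" "b > 0"
  shows "has_bochner_integral lborel
    (\<lambda>u. indicator {0<..<1} u * (u powr (a - 1) * (1 - u) powr (b - 1))) (Beta a b)"
proof (rule has_bochner_integral_nn_integral)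
  have "((\<lambda>t. t powr (a - 1) * (1 - t) powr (b - 1)) has_integral Beta a b) {0<..<1}"
    using has_integral_Beta_real[OF assms] by (simp add: has_integral_Icc_iff_Ioo)
  then have "((\<lambda>u. indicator {0<..<1} u * (u powr (a - 1) * (1 - u) powr (b - 1))) has_integral Beta a b) UNIV"
    by (subst (asm) has_integral_restrict_UNIV[symmetric]) (auto elim!: has_integral_eq[rotated])
  then show "(\<integral>\<^sup>+ u. ennreal (indicator {0<..<1} u * (u powr (a - 1) * (1 - u) powr (b - 1))) \<partial>lborel)
      = ennreal (Beta a b)"
    by (intro nn_integral_has_integral_lborel) (auto simp: indicator_def)
  show "0 \<le> Beta a b"
    using assms by (simp add: Beta_def Gamma_real_pos less_imp_le)
qed (auto simp: indicator_def)

text \<open>After the substitution s = t u the integrand, divided by \<open>A t * B t\<close>, tends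
  to \<open>(1 - u) powr (a - 1) * u powr (b - 1)\<close> for u between 0 and 1. The cutoff
  \<open>K\<close> keeps both arguments in the range of the Potter bounds, which majorize the
  integrand by a multiple of a Beta integrand with lowered exponents.\<close>

lemma regularly_varying_convolution:
  fixes A B :: "real \<Rightarrow> real"
  assumes A: "regularly_varying A (a - 1)" and B: "regularly_varying B (b - 1)"
    and a: "a > 0" and b: "b > 0"
  obtains K\<^sub>0 where "K\<^sub>0 > 0" "\<And>K. K \<ge> K\<^sub>0 \<Longrightarrow>
    ((\<lambda>t. (LINT s|lborel. indicator {K..t - K} s * (A (t - s) * B s)) / (t * A t * B t)) \<longlongrightarrow> Beta a b) at_top"
proof -
  note [measurable] = regularly_varyingD(1)[OF A] regularly_varyingD(1)[OF B]
  \<comment> \<open>Half of the smaller parameter leaves \<open>a - d\<close> and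
    \<open>b - d\<close> positive, so the majorant \<open>w\<close> is still integrable at both
    ends.\<close>
  define d where "d = min a b / 2"
  have d: "d > 0" "a - d > 0" "b - d > 0" using a b by (auto simp: d_def)
  obtain S where S: "S > 0" "\<And>t. t \<ge> S \<Longrightarrow> A t > 0"
    "\<And>s t. S \<le> s \<Longrightarrow> s \<le> t \<Longrightarrow> A s / A t \<le> exp d * (s / t) powr (a - 1 - d)"
    using Potter_bound_ratio[OF A d(1)] by metis
  obtain T where T: "T > 0" "\<And>t. t \<ge> T \<Longrightarrow> B t > 0"
    "\<And>s t. T \<le> s \<Longrightarrow> s \<le> t \<Longrightarrow> B s / B t \<le> exp d * (s / t) powr (b - 1 - d)"
    using Potter_bound_ratio[OF B d(1)] by metis
  show thesis
  proof (rule that[of "max S T"])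
    fix K assume K: "K \<ge> max S T"
    define g where "g t u = indicator {K..t - K} (t * u) * (A (t - t * u) / A t * (B (t * u) / B t))" for t u
    define w where "w u = exp d * exp d *
      (indicator {0<..<1} u * (u powr (b - d - 1) * (1 - u) powr (a - d - 1)))" for u
    have "((\<lambda>t. LINT u|lborel. g t u) \<longlongrightarrow>
        (LINT u|lborel. indicator {0<..<1} u * (u powr (b - 1) * (1 - u) powr (a - 1)))) at_top"
    proof (rule integral_dominated_convergence_at_top[where w = w])
      show "integrable lborel w"
        unfolding w_def using has_bochner_integral_Beta[OF d(3,2)]
        by (intro integrable_mult_right) (auto simp: has_bochner_integral_iff)
      show "AE u in lborel. ((\<lambda>t. g t u) \<longlongrightarrow> indicator {0<..<1} u * (u powr (b - 1) * (1 - u) powr (a - 1))) at_top"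
      proof (rule AE_I2)
        fix u :: real
        show "((\<lambda>t. g t u) \<longlongrightarrow> indicator {0<..<1} u * (u powr (b - 1) * (1 - u) powr (a - 1))) at_top"
        proof (cases "u \<in> {0<..<1}")
          case True
          then have u: "0 < u" "0 < 1 - u" by auto
          have lim: "((\<lambda>t. A (t * (1 - u)) / A t * (B (t * u) / B t)) \<longlongrightarrow>
              (1 - u) powr (a - 1) * u powr (b - 1)) at_top"
            using u by (intro tendsto_mult regularly_varyingD(3)[OF A] regularly_varyingD(3)[OF B])
          have "\<forall>\<^sub>F t in at_top. K \<le> t * u" "\<forall>\<^sub>F t in at_top. K \<le> t * (1 - u)"
            using u by real_asymp+
          then have ev: "\<forall>\<^sub>F t in at_top. A (t * (1 - u)) / A t * (B (t * u) / B t) = g t u"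
            by eventually_elim (simp add: g_def right_diff_distrib)
          have eq: "(1 - u) powr (a - 1) * u powr (b - 1) =
              indicator {0<..<1} u * (u powr (b - 1) * (1 - u) powr (a - 1))"
            using True by simp
          show ?thesis
            using Lim_transform_eventually[OF lim ev] unfolding eq .
        next
          case False
          have "g t u = 0" if "t > 0" for t
          proof -
            have False if tu: "K \<le> t * u" "t * u \<le> t - K"
            proof -
              have "K > 0" using K S(1) by simp
              then have *: "0 < t * u" "t * u < t * 1" using tu by linarith+
              have "0 < u" using *(1) \<open>t > 0\<close> by (simp add: zero_less_mult_iff)
              moreover have "u < 1"
                by (rule mult_less_cancel_left_pos[THEN iffD1, OF \<open>t > 0\<close> *(2)])
              ultimately show False using False by simp
            qed
            then have "t * u \<notin> {K..t - K}" by auto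
            then show ?thesis by (simp add: g_def)
          qed
          then have "\<forall>\<^sub>F t in at_top. indicator {0<..<1} u * (u powr (b - 1) * (1 - u) powr (a - 1)) = g t u"
            using False by (intro eventually_mono[OF eventually_gt_at_top[of 0]]) simp
          then show ?thesis by (rule Lim_transform_eventually[OF tendsto_const])
        qed
      qed
      have "norm (g t u) \<le> w u" if t: "t > 0" for t u
      proof (cases "t * u \<in> {K..t - K}")
        case True
        have tu: "S \<le> t * u" "T \<le> t * u" "S \<le> t - t * u" "T \<le> t - t * u" using True K by auto
        then have "0 < t * u" "0 < t - t * u" using S(1) by linarith+
        then have u: "0 < u" "u < 1" using t by (auto simp: zero_less_mult_iff)
        have le: "t * u \<le> t" "t - t * u \<le> t" using t u by auto
        have pos: "A (t - t * u) > 0" "A t > 0" "B (t * u) > 0" "B t > 0"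
          using tu le by (auto intro!: S(2) T(2))
        have "norm (g t u) = A (t - t * u) / A t * (B (t * u) / B t)"
          using True pos by (simp add: g_def)
        also have "\<dots> \<le> (exp d * ((t - t * u) / t) powr (a - 1 - d)) * (exp d * (t * u / t) powr (b - 1 - d))"
          using pos tu le by (intro mult_mono S(3) T(3)) auto
        also have "(t - t * u) / t = 1 - u" using t by (simp add: field_simps)
        also have "t * u / t = u" using t by simp
        finally show ?thesis using u by (simp add: w_def algebra_simps)
      qed (auto simp: g_def w_def indicator_def)
      then show "\<forall>\<^sub>F t in at_top. AE u in lborel. norm (g t u) \<le> w u"
        by (intro eventually_mono[OF eventually_gt_at_top[of 0]] AE_I2)
    qed (auto simp: g_def)
    moreover have "(LINT u|lborel. indicator {0<..<1} u * (u powr (b - 1) * (1 - u) powr (a - 1))) = Beta a b"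
      using has_bochner_integral_Beta[OF b a] by (simp add: has_bochner_integral_iff Beta_commute)
    moreover have "\<forall>\<^sub>F t in at_top. (LINT u|lborel. g t u) =
        (LINT s|lborel. indicator {K..t - K} s * (A (t - s) * B s)) / (t * A t * B t)"
      using eventually_gt_at_top[of 0]
    proof eventually_elim
      case (elim t)
      have "(LINT s|lborel. indicator {K..t - K} s * (A (t - s) * B s)) =
          t * (LINT u|lborel. indicator {K..t - K} (t * u) * (A (t - t * u) * B (t * u)))"
        using elim lborel_integral_real_affine[of t "\<lambda>s. indicator {K..t - K} s * (A (t - s) * B s)" 0] by simp
      moreover have "g t u = indicator {K..t - K} (t * u) * (A (t - t * u) * B (t * u)) / (A t * B t)" for u
        by (simp add: g_def)
      ultimately show ?case using elim by simp
    qed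
    ultimately show "((\<lambda>t. (LINT s|lborel. indicator {K..t - K} s * (A (t - s) * B s)) / (t * A t * B t))
        \<longlongrightarrow> Beta a b) at_top"
      by (auto intro: Lim_transform_eventually)
  qed (use S in auto)
qed

section \<open>Scaled tails and products of independent variables\<close>

context prob_space
begin

definition scaled_tail :: "real \<Rightarrow> ('a \<Rightarrow> real) \<Rightarrow> real \<Rightarrow> real" where
  "scaled_tail \<alpha> U t = exp (\<alpha> * t) * \<P>(\<omega> in M. U \<omega> > exp t)"

lemma tail_antimono:
  fixes U :: "'a \<Rightarrow> real" and x y :: real
  assumes [measurable]: "random_variable borel U" and "x \<le> y"
  shows "\<P>(\<omega> in M. U \<omega> > y) \<le> \<P>(\<omega> in M. U \<omega> > x)"
proof (rule finite_measure_mono)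
  show "{\<omega>\<in>space M. U \<omega> > y} \<subseteq> {\<omega>\<in>space M. U \<omega> > x}" using assms(2) by auto
qed measurable

lemma borel_measurable_tail:
  assumes [measurable]: "random_variable borel U"
  shows "(\<lambda>t :: real. \<P>(\<omega> in M. U \<omega> > exp t)) \<in> borel_measurable borel"
proof -
  have "mono (\<lambda>t :: real. - \<P>(\<omega> in M. U \<omega> > exp t))"
    by (intro monoI le_imp_neg_le tail_antimono[OF assms]) simp
  from borel_measurable_mono[OF this] show ?thesis by simp
qed

lemma borel_measurable_scaled_tail [measurable]:
  "random_variable borel U \<Longrightarrow> scaled_tail \<alpha> U \<in> borel_measurable borel"
  unfolding scaled_tail_def[abs_def] using borel_measurable_tail[of U] by measurable

lemma scaled_tail_nonneg: "0 \<le> scaled_tail \<alpha> U t"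
  by (simp add: scaled_tail_def)

lemma tail_eq_scaled_tail: "\<P>(\<omega> in M. U \<omega> > exp t) = exp (- \<alpha> * t) * scaled_tail \<alpha> U t"
  by (simp add: scaled_tail_def exp_minus)

lemma indep_var_prob_conj:
  assumes ind: "indep_var S U T V" and "Measurable.pred S P" "Measurable.pred T Q"
  shows "\<P>(\<omega> in M. P (U \<omega>) \<and> Q (V \<omega>)) = \<P>(\<omega> in M. P (U \<omega>)) * \<P>(\<omega> in M. Q (V \<omega>))"
proof -
  have meas: "U \<in> measurable M S" "V \<in> measurable M T"
    using indep_var_rv1[OF ind] indep_var_rv2[OF ind] .
  have "prob ((\<lambda>\<omega>. (U \<omega>, V \<omega>)) -` ({x\<in>space S. P x} \<times> {x\<in>space T. Q x}) \<inter> space M) =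
      prob (U -` {x\<in>space S. P x} \<inter> space M) * prob (V -` {x\<in>space T. Q x} \<inter> space M)"
    by (rule indep_varD[OF ind]) (use assms in auto)
  moreover have "(\<lambda>\<omega>. (U \<omega>, V \<omega>)) -` ({x\<in>space S. P x} \<times> {x\<in>space T. Q x}) \<inter> space M =
      {\<omega>\<in>space M. P (U \<omega>) \<and> Q (V \<omega>)}"
    "U -` {x\<in>space S. P x} \<inter> space M = {\<omega>\<in>space M. P (U \<omega>)}"
    "V -` {x\<in>space T. Q x} \<inter> space M = {\<omega>\<in>space M. Q (V \<omega>)}"
    using meas[THEN measurable_space] by auto
  ultimately show ?thesis by simp
qed

text \<open>Tonelli, prepared for averaging over windows: the left side is the mean length of the
  set of times \<open>s\<close> in the interval at which \<open>R s\<close> occurs.\<close>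

lemma nn_integral_indicator_prob_swap:
  fixes R :: "real \<Rightarrow> 'a \<Rightarrow> bool"
  assumes [measurable]: "Measurable.pred (M \<Otimes>\<^sub>M lborel) (\<lambda>(\<omega>, s). R s \<omega>)"
  shows "(\<integral>\<^sup>+\<omega>. \<integral>\<^sup>+s. indicator {a..b} s * indicator {\<omega>. R s \<omega>} \<omega> \<partial>lborel \<partial>M) =
    (\<integral>\<^sup>+s. ennreal (indicator {a..b} s * \<P>(\<omega> in M. R s \<omega>)) \<partial>lborel)"
proof -
  interpret pair_sigma_finite M "lborel :: real measure" ..
  have "(\<lambda>(\<omega>, s). indicator {a..b} s * indicator {\<omega>. R s \<omega>} \<omega> :: ennreal)
      \<in> borel_measurable (M \<Otimes>\<^sub>M lborel)"
    by (simp add: indicator_def of_bool_def split_beta') measurable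
  from Fubini'[OF this]
  have "(\<integral>\<^sup>+\<omega>. \<integral>\<^sup>+s. indicator {a..b} s * indicator {\<omega>. R s \<omega>} \<omega> \<partial>lborel \<partial>M) =
      (\<integral>\<^sup>+s. \<integral>\<^sup>+\<omega>. indicator {a..b} s * indicator {\<omega>. R s \<omega>} \<omega> \<partial>M \<partial>lborel)"
    by simp
  also have "\<dots> = (\<integral>\<^sup>+s. ennreal (indicator {a..b} s * \<P>(\<omega> in M. R s \<omega>)) \<partial>lborel)"
  proof (rule nn_integral_cong)
    fix s :: real
    have [measurable]: "Measurable.pred M (R s)"
      using measurable_compose[OF measurable_Pair2'[of s lborel M] assms] by simp
    have "(\<integral>\<^sup>+\<omega>. indicator {a..b} s * indicator {\<omega>. R s \<omega>} \<omega> \<partial>M) =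
        indicator {a..b} s * (\<integral>\<^sup>+\<omega>. indicator {\<omega>\<in>space M. R s \<omega>} \<omega> \<partial>M)"
      by (subst nn_integral_cmult[symmetric]) (auto intro!: nn_integral_cong simp: indicator_def)
    also have "(\<integral>\<^sup>+\<omega>. indicator {\<omega>\<in>space M. R s \<omega>} \<omega> \<partial>M) = ennreal \<P>(\<omega> in M. R s \<omega>)"
      by (subst nn_integral_indicator) (simp_all add: emeasure_eq_measure)
    also have "indicator {a..b} s * \<dots> = ennreal (indicator {a..b} s * \<P>(\<omega> in M. R s \<omega>))"
      by (simp add: indicator_def)
    finally show "(\<integral>\<^sup>+\<omega>. indicator {a..b} s * indicator {\<omega>. R s \<omega>} \<omega> \<partial>M) =
        ennreal (indicator {a..b} s * \<P>(\<omega> in M. R s \<omega>))" .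
  qed
  finally show ?thesis .
qed

text \<open>In both bounds the event is averaged over a window of length h for s next to ln V, on the side where
  replacing V by exp s enlarges (respectively shrinks) it; no disintegration along V is then needed.\<close>

lemma product_tail_upper:
  fixes U V :: "'a \<Rightarrow> real"
  assumes ind: "indep_var borel U borel V" and h: "h > 0"
  shows "ennreal (h * \<P>(\<omega> in M. U \<omega> * V \<omega> > exp t \<and> exp a < V \<omega> \<and> V \<omega> \<le> exp b)) \<le>
    (\<integral>\<^sup>+s. ennreal (indicator {a..b + h} s *
       (\<P>(\<omega> in M. U \<omega> > exp (t - s)) * \<P>(\<omega> in M. exp (s - h) < V \<omega> \<and> V \<omega> \<le> exp s))) \<partial>lborel)"
proof -
  note [measurable] = indep_var_rv1[OF ind] indep_var_rv2[OF ind]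
  define R where "R s \<omega> \<longleftrightarrow> U \<omega> > exp (t - s) \<and> exp (s - h) < V \<omega> \<and> V \<omega> \<le> exp s" for s \<omega>
  have prob_R: "\<P>(\<omega> in M. R s \<omega>) =
      \<P>(\<omega> in M. U \<omega> > exp (t - s)) * \<P>(\<omega> in M. exp (s - h) < V \<omega> \<and> V \<omega> \<le> exp s)" for s
    unfolding R_def by (intro indep_var_prob_conj[OF ind]) measurable
  define E where "E = {\<omega>\<in>space M. U \<omega> * V \<omega> > exp t \<and> exp a < V \<omega> \<and> V \<omega> \<le> exp b}"
  have [measurable]: "E \<in> sets M" unfolding E_def by measurable
  have "ennreal (h * prob E) = (\<integral>\<^sup>+\<omega>. ennreal h * indicator E \<omega> \<partial>M)"
    using h by (simp add: nn_integral_cmult emeasure_eq_measure ennreal_mult)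
  also have "\<dots> \<le> (\<integral>\<^sup>+\<omega>. \<integral>\<^sup>+s. indicator {a..b + h} s * indicator {\<omega>. R s \<omega>} \<omega> \<partial>lborel \<partial>M)"
  proof (rule nn_integral_mono)
    fix \<omega>
    show "ennreal h * indicator E \<omega> \<le> (\<integral>\<^sup>+s. indicator {a..b + h} s * indicator {\<omega>. R s \<omega>} \<omega> \<partial>lborel)"
    proof (cases "\<omega> \<in> E")
      case True
      then have E: "U \<omega> * V \<omega> > exp t" "exp a < V \<omega>" "V \<omega> \<le> exp b" by (auto simp: E_def)
      have pos: "V \<omega> > 0" using E(2) by (metis exp_gt_zero less_trans)
      define W where "W = ln (V \<omega>)"
      have V: "V \<omega> = exp W" using pos by (simp add: W_def)
      have W: "a < W" "W \<le> b" using E(2,3) V by auto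
      have U: "U \<omega> > exp (t - W)" using E(1) by (simp add: V exp_diff pos_divide_less_eq)
      \<comment> \<open>On the whole window from \<open>W\<close> to \<open>W + h\<close> the event
        \<open>R s\<close> occurs: \<open>V\<close> lies in the band belonging to \<open>s\<close>,
        and \<open>s \<ge> W\<close> only lowers the threshold for \<open>U\<close>. The band is
        half-open on the left, so the window is half-open on the right and has length exactly
        \<open>h\<close>.\<close>
      have "ennreal h = (\<integral>\<^sup>+s. indicator {W..<W + h} s \<partial>lborel)" using h by simp
      also have "\<dots> \<le> (\<integral>\<^sup>+s. indicator {a..b + h} s * indicator {\<omega>. R s \<omega>} \<omega> \<partial>lborel)"
      proof (rule nn_integral_mono)
        fix s
        have "exp (t - s) < U \<omega>" if "W \<le> s"
          using that by (intro le_less_trans[OF _ U]) simp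
        then show "(indicator {W..<W + h} s :: ennreal) \<le> indicator {a..b + h} s * indicator {\<omega>. R s \<omega>} \<omega>"
          using W by (auto simp: indicator_def R_def V)
      qed
      finally show ?thesis using True by simp
    qed simp
  qed
  also have "\<dots> = (\<integral>\<^sup>+s. ennreal (indicator {a..b + h} s * \<P>(\<omega> in M. R s \<omega>)) \<partial>lborel)"
    unfolding R_def by (intro nn_integral_indicator_prob_swap) measurable
  finally show ?thesis
    unfolding E_def prob_R .
qed

lemma product_tail_lower:
  fixes U V :: "'a \<Rightarrow> real"
  assumes ind: "indep_var borel U borel V" and h: "h > 0"
  shows "(\<integral>\<^sup>+s. ennreal (indicator {a..b} s *
       (\<P>(\<omega> in M. U \<omega> > exp (t - s)) * \<P>(\<omega> in M. exp s < V \<omega> \<and> V \<omega> \<le> exp (s + h)))) \<partial>lborel)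
    \<le> ennreal (h * \<P>(\<omega> in M. U \<omega> * V \<omega> > exp t))"
proof -
  note [measurable] = indep_var_rv1[OF ind] indep_var_rv2[OF ind]
  define R where "R s \<omega> \<longleftrightarrow> U \<omega> > exp (t - s) \<and> exp s < V \<omega> \<and> V \<omega> \<le> exp (s + h)" for s \<omega>
  define E where "E = {\<omega>\<in>space M. U \<omega> * V \<omega> > exp t}"
  have [measurable]: "E \<in> sets M" unfolding E_def by measurable
  have prob_R: "\<P>(\<omega> in M. R s \<omega>) =
      \<P>(\<omega> in M. U \<omega> > exp (t - s)) * \<P>(\<omega> in M. exp s < V \<omega> \<and> V \<omega> \<le> exp (s + h))" for s
    unfolding R_def by (intro indep_var_prob_conj[OF ind]) measurable
  have "(\<integral>\<^sup>+s. ennreal (indicator {a..b} s * \<P>(\<omega> in M. R s \<omega>)) \<partial>lborel) =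
      (\<integral>\<^sup>+\<omega>. \<integral>\<^sup>+s. indicator {a..b} s * indicator {\<omega>. R s \<omega>} \<omega> \<partial>lborel \<partial>M)"
    unfolding R_def by (intro nn_integral_indicator_prob_swap[symmetric]) measurable
  also have "\<dots> \<le> (\<integral>\<^sup>+\<omega>. ennreal h * indicator E \<omega> \<partial>M)"
  proof (rule nn_integral_mono)
    fix \<omega> assume \<omega>: "\<omega> \<in> space M"
    define W where "W = ln (V \<omega>)"
    \<comment> \<open>Here the inclusion is reversed: \<open>R s\<close> puts \<open>s\<close> into
      the window of length \<open>h\<close> just below \<open>W\<close>, and there exceeding
      \<open>exp (t - s)\<close> is more than \<open>U\<close> must do for the product to exceed
      \<open>exp t\<close>.\<close>
    have "(\<integral>\<^sup>+s. indicator {a..b} s * indicator {\<omega>. R s \<omega>} \<omega> \<partial>lborel) \<le>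
        (\<integral>\<^sup>+s. indicator {W - h..<W} s * indicator E \<omega> \<partial>lborel)"
    proof (rule nn_integral_mono)
      fix s
      have "W - h \<le> s \<and> s < W \<and> \<omega> \<in> E" if R: "R s \<omega>"
      proof -
        have "V \<omega> > 0" using R unfolding R_def by (metis exp_gt_zero less_trans)
        then have V: "V \<omega> = exp W" by (simp add: W_def)
        then have W: "W - h \<le> s" "s < W" using R by (auto simp: R_def)
        have "exp t < exp (t - s) * exp W" using W by (simp flip: exp_add)
        also have "\<dots> < U \<omega> * exp W" using R by (simp add: R_def)
        finally show ?thesis using W \<omega> by (simp add: E_def V)
      qed
      then show "(indicator {a..b} s * indicator {\<omega>. R s \<omega>} \<omega> :: ennreal) \<le> indicator {W - h..<W} s * indicator E \<omega>"
        by (auto simp: indicator_def)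
    qed
    also have "\<dots> = ennreal h * indicator E \<omega>"
      using h by (subst nn_integral_multc) auto
    finally show "(\<integral>\<^sup>+s. indicator {a..b} s * indicator {\<omega>. R s \<omega>} \<omega> \<partial>lborel) \<le> ennreal h * indicator E \<omega>" .
  qed
  also have "\<dots> = ennreal (h * prob E)"
    using h by (simp add: nn_integral_cmult emeasure_eq_measure ennreal_mult)
  finally show ?thesis
    unfolding E_def prob_R .
qed


lemma prob_between:
  fixes V :: "'a \<Rightarrow> real"
  assumes [measurable]: "random_variable borel V" and "x \<le> y"
  shows "\<P>(\<omega> in M. x < V \<omega> \<and> V \<omega> \<le> y) = \<P>(\<omega> in M. V \<omega> > x) - \<P>(\<omega> in M. V \<omega> > y)"
proof -
  have "{\<omega>\<in>space M. x < V \<omega> \<and> V \<omega> \<le> y} = {\<omega>\<in>space M. V \<omega> > x} - {\<omega>\<in>space M. V \<omega> > y}"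
    by auto
  moreover have "{\<omega>\<in>space M. V \<omega> > y} \<subseteq> {\<omega>\<in>space M. V \<omega> > x}"
    using assms(2) by auto
  ultimately show ?thesis
    by (simp add: finite_measure_Diff)
qed

text \<open>The probabilities are at most 1 and the two exponential weights multiply to
  \<open>exp (\<alpha> * t)\<close>, which is constant in \<open>s\<close>.\<close>

lemma integrable_scaled_tail_convolution:
  fixes U V :: "'a \<Rightarrow> real"
  assumes [measurable]: "random_variable borel U" "random_variable borel V"
  shows "integrable lborel (\<lambda>s. indicator {a..b} s * (scaled_tail \<alpha> U (t - s) * scaled_tail \<alpha> V s))"
proof (rule Bochner_Integration.integrable_bound)
  show "integrable lborel (\<lambda>s. exp (\<alpha> * t) * indicator {a..b} s :: real)"
    by (intro integrable_mult_right integrable_real_indicator) (auto simp: emeasure_lborel_Icc_eq)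
  show "AE s in lborel. norm (indicator {a..b} s * (scaled_tail \<alpha> U (t - s) * scaled_tail \<alpha> V s)) \<le>
      norm (exp (\<alpha> * t) * indicator {a..b} s :: real)"
  proof (rule AE_I2)
    fix s :: real
    have "scaled_tail \<alpha> U (t - s) * scaled_tail \<alpha> V s \<le> exp (\<alpha> * (t - s)) * exp (\<alpha> * s)"
      unfolding scaled_tail_def by (intro mult_mono mult_left_le) auto
    also have "\<dots> = exp (\<alpha> * t)" by (simp add: algebra_simps flip: exp_add)
    finally show "norm (indicator {a..b} s * (scaled_tail \<alpha> U (t - s) * scaled_tail \<alpha> V s)) \<le>
        norm (exp (\<alpha> * t) * indicator {a..b} s :: real)"
      by (simp add: scaled_tail_nonneg abs_mult indicator_def)
  qed
qed measurable

text \<open>Up to the factor \<open>exp (- \<alpha> * s)\<close>, the left side of hypothesis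
  \<open>B\<close> is the mass of ln V between \<open>s - h\<close> and \<open>s\<close>. Inserted
  into the window average it leaves the factor \<open>h\<close>, which cancels against the one from
  averaging. The cutoff becomes \<open>K - h\<close> because the windows reach up to
  \<open>t - K + h\<close> and the convolution integral is kept symmetric.\<close>

lemma scaled_tail_product_upper:
  fixes U V :: "'a \<Rightarrow> real"
  assumes ind: "indep_var borel U borel V" and h: "h > 0" and c: "c \<ge> 0"
    and B: "\<And>s. s \<ge> K \<Longrightarrow> exp (\<alpha> * h) * scaled_tail \<alpha> V (s - h) - scaled_tail \<alpha> V s \<le> c * h * scaled_tail \<alpha> V s"
  shows "exp (\<alpha> * t) * \<P>(\<omega> in M. U \<omega> * V \<omega> > exp t \<and> exp K < V \<omega> \<and> V \<omega> \<le> exp (t - K)) \<le>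
    c * (LINT s|lborel. indicator {K - h..t - (K - h)} s * (scaled_tail \<alpha> U (t - s) * scaled_tail \<alpha> V s))"
    (is "_ * ?P \<le> c * (LINT s|lborel. ?f s)")
proof -
  note rv[measurable] = indep_var_rv1[OF ind] indep_var_rv2[OF ind]
  let ?k = "exp (- \<alpha> * t) * (c * h)"
  have "ennreal (h * ?P) \<le> (\<integral>\<^sup>+s. ennreal (indicator {K..t - K + h} s *
       (\<P>(\<omega> in M. U \<omega> > exp (t - s)) * \<P>(\<omega> in M. exp (s - h) < V \<omega> \<and> V \<omega> \<le> exp s))) \<partial>lborel)"
    by (rule product_tail_upper[OF ind h])
  also have "\<dots> \<le> (\<integral>\<^sup>+s. ennreal (?k * ?f s) \<partial>lborel)"
  proof (intro nn_integral_mono ennreal_leI)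
    fix s
    show "indicator {K..t - K + h} s * (\<P>(\<omega> in M. U \<omega> > exp (t - s)) * \<P>(\<omega> in M. exp (s - h) < V \<omega> \<and> V \<omega> \<le> exp s))
      \<le> ?k * ?f s"
    proof (cases "s \<in> {K..t - K + h}")
      case True
      have "\<P>(\<omega> in M. exp (s - h) < V \<omega> \<and> V \<omega> \<le> exp s) =
          \<P>(\<omega> in M. V \<omega> > exp (s - h)) - \<P>(\<omega> in M. V \<omega> > exp s)"
        using h by (intro prob_between) auto
      also have "\<dots> = exp (- \<alpha> * s) * (exp (\<alpha> * h) * scaled_tail \<alpha> V (s - h) - scaled_tail \<alpha> V s)"
        by (simp add: scaled_tail_def algebra_simps flip: exp_add mult.assoc)
      also have "\<dots> \<le> exp (- \<alpha> * s) * (c * h * scaled_tail \<alpha> V s)"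
        using True by (intro mult_left_mono B) auto
      finally have "\<P>(\<omega> in M. U \<omega> > exp (t - s)) * \<P>(\<omega> in M. exp (s - h) < V \<omega> \<and> V \<omega> \<le> exp s) \<le>
          (exp (- \<alpha> * (t - s)) * scaled_tail \<alpha> U (t - s)) * (exp (- \<alpha> * s) * (c * h * scaled_tail \<alpha> V s))"
        unfolding tail_eq_scaled_tail[of "t - s" U \<alpha>]
        by (intro mult_left_mono) (auto simp: scaled_tail_nonneg)
      also have "\<dots> = exp (- \<alpha> * (t - s) + - \<alpha> * s) * (c * h) * (scaled_tail \<alpha> U (t - s) * scaled_tail \<alpha> V s)"
        by (simp only: exp_add mult_ac)
      also have "- \<alpha> * (t - s) + - \<alpha> * s = - \<alpha> * t" by (simp add: algebra_simps)
      finally show ?thesis using True h by (simp add: indicator_def)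
    qed (use c h in \<open>simp add: scaled_tail_nonneg\<close>)
  qed
  also have "\<dots> = ennreal (LINT s|lborel. ?k * ?f s)"
    using c h
    by (intro nn_integral_eq_integral integrable_mult_right integrable_scaled_tail_convolution rv)
       (auto simp: scaled_tail_nonneg)
  also have "(LINT s|lborel. ?k * ?f s) = ?k * (LINT s|lborel. ?f s)" by simp
  finally have "h * ?P \<le> ?k * (LINT s|lborel. ?f s)"
    using c h by (subst (asm) ennreal_le_iff)
      (auto intro!: mult_nonneg_nonneg Bochner_Integration.integral_nonneg simp: scaled_tail_nonneg)
  then have "exp (\<alpha> * t) * (h * ?P) \<le> exp (\<alpha> * t) * (?k * (LINT s|lborel. ?f s))"
    by (intro mult_left_mono) auto
  also have "\<dots> = h * (c * (LINT s|lborel. ?f s))" by (simp add: exp_minus)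
  finally show ?thesis using h by simp
qed

text \<open>The mirror image, with the mass of ln V between \<open>s\<close> and
  \<open>s + h\<close>. Dropping what lies outside the cutoff is harmless in a lower bound, so the
  full tail of the product appears and the cutoff stays at \<open>K\<close>.\<close>

lemma scaled_tail_product_lower:
  fixes U V :: "'a \<Rightarrow> real"
  assumes ind: "indep_var borel U borel V" and h: "h > 0" and c: "c \<ge> 0"
    and B: "\<And>s. s \<ge> K \<Longrightarrow> c * h * scaled_tail \<alpha> V s \<le> scaled_tail \<alpha> V s - exp (- \<alpha> * h) * scaled_tail \<alpha> V (s + h)"
  shows "c * (LINT s|lborel. indicator {K..t - K} s * (scaled_tail \<alpha> U (t - s) * scaled_tail \<alpha> V s)) \<le>
    scaled_tail \<alpha> (\<lambda>\<omega>. U \<omega> * V \<omega>) t"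
    (is "c * (LINT s|lborel. ?f s) \<le> _")
proof -
  note rv[measurable] = indep_var_rv1[OF ind] indep_var_rv2[OF ind]
  let ?k = "exp (- \<alpha> * t) * (c * h)"
  let ?P = "\<P>(\<omega> in M. U \<omega> * V \<omega> > exp t)"
  have "ennreal (?k * (LINT s|lborel. ?f s)) = ennreal (LINT s|lborel. ?k * ?f s)" by simp
  also have "\<dots> = (\<integral>\<^sup>+s. ennreal (?k * ?f s) \<partial>lborel)"
    using c h
    by (intro nn_integral_eq_integral[symmetric] integrable_mult_right integrable_scaled_tail_convolution rv)
       (auto simp: scaled_tail_nonneg)
  also have "\<dots> \<le> (\<integral>\<^sup>+s. ennreal (indicator {K..t - K} s *
       (\<P>(\<omega> in M. U \<omega> > exp (t - s)) * \<P>(\<omega> in M. exp s < V \<omega> \<and> V \<omega> \<le> exp (s + h)))) \<partial>lborel)"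
  proof (intro nn_integral_mono ennreal_leI)
    fix s
    show "?k * ?f s \<le> indicator {K..t - K} s *
      (\<P>(\<omega> in M. U \<omega> > exp (t - s)) * \<P>(\<omega> in M. exp s < V \<omega> \<and> V \<omega> \<le> exp (s + h)))"
    proof (cases "s \<in> {K..t - K}")
      case True
      have "- \<alpha> * t = - \<alpha> * (t - s) + - \<alpha> * s" by (simp add: algebra_simps)
      then have "?k * (scaled_tail \<alpha> U (t - s) * scaled_tail \<alpha> V s) =
          (exp (- \<alpha> * (t - s)) * scaled_tail \<alpha> U (t - s)) * (exp (- \<alpha> * s) * (c * h * scaled_tail \<alpha> V s))"
        by (simp only: exp_add mult_ac)
      also have "\<dots> \<le> (exp (- \<alpha> * (t - s)) * scaled_tail \<alpha> U (t - s)) *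
          (exp (- \<alpha> * s) * (scaled_tail \<alpha> V s - exp (- \<alpha> * h) * scaled_tail \<alpha> V (s + h)))"
        using True by (intro mult_left_mono B) (auto simp: scaled_tail_nonneg)
      also have "exp (- \<alpha> * s) * (scaled_tail \<alpha> V s - exp (- \<alpha> * h) * scaled_tail \<alpha> V (s + h)) =
          \<P>(\<omega> in M. V \<omega> > exp s) - \<P>(\<omega> in M. V \<omega> > exp (s + h))"
        by (simp add: scaled_tail_def algebra_simps flip: exp_add mult.assoc)
      also have "\<dots> = \<P>(\<omega> in M. exp s < V \<omega> \<and> V \<omega> \<le> exp (s + h))"
        using h by (intro prob_between[symmetric]) auto
      also have "exp (- \<alpha> * (t - s)) * scaled_tail \<alpha> U (t - s) = \<P>(\<omega> in M. U \<omega> > exp (t - s))"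
        by (rule tail_eq_scaled_tail[symmetric])
      finally show ?thesis using True by (simp add: indicator_def)
    qed simp
  qed
  also have "\<dots> \<le> ennreal (h * ?P)"
    by (rule product_tail_lower[OF ind h])
  finally have "?k * (LINT s|lborel. ?f s) \<le> h * ?P"
    using h by (subst (asm) ennreal_le_iff) auto
  then have "exp (\<alpha> * t) * (?k * (LINT s|lborel. ?f s)) \<le> exp (\<alpha> * t) * (h * ?P)"
    by (intro mult_left_mono) auto
  moreover have "exp (\<alpha> * t) * (?k * (LINT s|lborel. ?f s)) = h * (c * (LINT s|lborel. ?f s))"
    by (simp add: exp_minus)
  moreover have "exp (\<alpha> * t) * (h * ?P) = h * scaled_tail \<alpha> (\<lambda>\<omega>. U \<omega> * V \<omega>) t"
    by (simp add: scaled_tail_def)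
  ultimately show ?thesis using h by (simp only: mult_le_cancel_left_pos)
qed


text \<open>The ratio is squeezed between c * Beta a b for c on either side of \<open>\<alpha>\<close>, because both
  (exp (\<open>\<alpha>\<close> h) - 1) / h and (1 - exp (- \<open>\<alpha>\<close> h)) / h tend to \<open>\<alpha>\<close> as h tends to 0. The ranges
  where ln V or t - ln V is bounded do not contribute.\<close>

lemma tendsto_scaled_tail_product:
  fixes U V :: "'a \<Rightarrow> real"
  assumes ind: "indep_var borel U borel V" and pos: "AE \<omega> in M. V \<omega> > 0"
    and \<alpha>: "\<alpha> > 0" and a: "a > 0" and b: "b > 0"
    and A: "regularly_varying (scaled_tail \<alpha> U) (a - 1)"
    and B: "regularly_varying (scaled_tail \<alpha> V) (b - 1)"
  shows "((\<lambda>t. scaled_tail \<alpha> (\<lambda>\<omega>. U \<omega> * V \<omega>) t / (t * scaled_tail \<alpha> U t * scaled_tail \<alpha> V t))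
    \<longlongrightarrow> \<alpha> * Beta a b) at_top"
proof -
  note rv[measurable] = indep_var_rv1[OF ind] indep_var_rv2[OF ind]
  let ?A = "scaled_tail \<alpha> U" and ?B = "scaled_tail \<alpha> V" and ?L = "scaled_tail \<alpha> (\<lambda>\<omega>. U \<omega> * V \<omega>)"
  define D where "D t = t * ?A t * ?B t" for t
  define J where "J K t = (LINT s|lborel. indicator {K..t - K} s * (?A (t - s) * ?B s))" for K t
  obtain K\<^sub>0 where K\<^sub>0: "K\<^sub>0 > 0" "\<And>K. K \<ge> K\<^sub>0 \<Longrightarrow> ((\<lambda>t. J K t / D t) \<longlongrightarrow> Beta a b) at_top"
    unfolding J_def D_def by (rule regularly_varying_convolution[OF A B a b]) blast
  have Beta: "Beta a b > 0" using a b by (simp add: Beta_def Gamma_real_pos)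
  have D_pos: "\<forall>\<^sub>F t in at_top. D t > 0"
    using regularly_varyingD(2)[OF A] regularly_varyingD(2)[OF B] eventually_gt_at_top[of 0]
    by eventually_elim (simp add: D_def)
  have B_pos: "\<forall>\<^sub>F s in at_top. ?B s > 0" by (rule regularly_varyingD(2)[OF B])
  \<comment> \<open>The ratio is a shift quotient of \<open>?A\<close>, tending to 1, times the
    inverse of \<open>t * ?B t\<close>. The latter function has index \<open>b > 0\<close>, so its
    inverse vanishes. \<open>small_B\<close> exchanges the roles.\<close>
  have small_A: "((\<lambda>t. exp (\<alpha> * K) * ?A (t - K) / D t) \<longlongrightarrow> 0) at_top" for K
  proof -
    have "((\<lambda>t. inverse (t * ?B t)) \<longlongrightarrow> 0) at_top"
      by (rule regularly_varying_negative_tendsto_0[OF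
            regularly_varying_inverse[OF regularly_varying_mult[OF regularly_varying_ident B]]])
         (use b in simp)
    then have "((\<lambda>t. exp (\<alpha> * K) * (?A (t + - K) / ?A t * inverse (t * ?B t))) \<longlongrightarrow> exp (\<alpha> * K) * (1 * 0)) at_top"
      by (intro tendsto_intros regularly_varying_shift[OF A])
    then show ?thesis by (simp add: D_def field_simps)
  qed
  have small_B: "((\<lambda>t. exp (\<alpha> * K) * ?B (t - K) / D t) \<longlongrightarrow> 0) at_top" for K
  proof -
    have "((\<lambda>t. inverse (t * ?A t)) \<longlongrightarrow> 0) at_top"
      by (rule regularly_varying_negative_tendsto_0[OF
            regularly_varying_inverse[OF regularly_varying_mult[OF regularly_varying_ident A]]])
         (use a in simp)
    then have "((\<lambda>t. exp (\<alpha> * K) * (?B (t + - K) / ?B t * inverse (t * ?A t))) \<longlongrightarrow> exp (\<alpha> * K) * (1 * 0)) at_top"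
      by (intro tendsto_intros regularly_varying_shift[OF B])
    then show ?thesis by (simp add: D_def field_simps)
  qed
  have upper: "\<forall>\<^sub>F t in at_top. ?L t / D t < y" if y: "y > \<alpha> * Beta a b" for y
  proof -
    have "\<alpha> < y / Beta a b" using y Beta by (simp add: field_simps)
    then obtain c where c: "\<alpha> < c" "c < y / Beta a b" using dense by blast
    have cy: "c * Beta a b < y" using c(2) Beta by (simp add: field_simps)
    have "((\<lambda>h. (exp (\<alpha> * h) - 1) / h) \<longlongrightarrow> \<alpha>) (at_right 0)" by real_asymp
    from order_tendstoD(2)[OF this c(1)]
    have "\<forall>\<^sub>F h in at_right 0. (exp (\<alpha> * h) - 1) / h < c \<and> h > 0"
      by (auto simp: eventually_conj_iff eventually_at_right_less)
    then obtain h where h: "h > 0" "(exp (\<alpha> * h) - 1) / h < c"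
      using eventually_happens[of _ "at_right (0 :: real)"] by (auto simp: trivial_limit_at_right_real)
    have "((\<lambda>s. exp (\<alpha> * h) * (?B (s + - h) / ?B s) - 1) \<longlongrightarrow> exp (\<alpha> * h) * 1 - 1) at_top"
      by (intro tendsto_intros regularly_varying_shift[OF B])
    moreover have "exp (\<alpha> * h) * 1 - 1 < c * h" using h by (simp add: field_simps)
    ultimately have "\<forall>\<^sub>F s in at_top. exp (\<alpha> * h) * (?B (s + - h) / ?B s) - 1 < c * h"
      by (rule order_tendstoD)
    with B_pos have "\<forall>\<^sub>F s in at_top. exp (\<alpha> * h) * ?B (s - h) - ?B s \<le> c * h * ?B s"
      by eventually_elim (simp add: field_simps)
    then obtain K\<^sub>1 where K\<^sub>1: "\<And>s. s \<ge> K\<^sub>1 \<Longrightarrow> exp (\<alpha> * h) * ?B (s - h) - ?B s \<le> c * h * ?B s"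
      by (auto simp: eventually_at_top_linorder)
    \<comment> \<open>The upper bound produces a convolution cut off at \<open>K - h\<close>, which
      must not fall below \<open>K\<^sub>0\<close>.\<close>
    define K where "K = max K\<^sub>1 (K\<^sub>0 + h)"
    \<comment> \<open>Outside the middle range one factor is large on its own: if
      \<open>V \<omega> \<le> exp K\<close>, positivity of \<open>V\<close> forces
      \<open>U \<omega> > exp (t - K)\<close>; otherwise
      \<open>V \<omega> > exp (t - K)\<close>.\<close>
    have bound: "?L t \<le> c * J (K - h) t + exp (\<alpha> * K) * ?A (t - K) + exp (\<alpha> * K) * ?B (t - K)" for t
    proof -
      let ?m = "\<P>(\<omega> in M. U \<omega> * V \<omega> > exp t \<and> exp K < V \<omega> \<and> V \<omega> \<le> exp (t - K))"
      have "\<P>(\<omega> in M. U \<omega> * V \<omega> > exp t) \<le>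
          prob ({\<omega>\<in>space M. U \<omega> * V \<omega> > exp t \<and> exp K < V \<omega> \<and> V \<omega> \<le> exp (t - K)} \<union>
            {\<omega>\<in>space M. U \<omega> > exp (t - K)} \<union> {\<omega>\<in>space M. V \<omega> > exp (t - K)})"
      proof (rule finite_measure_mono_AE)
        show "AE \<omega> in M. \<omega> \<in> {\<omega>\<in>space M. U \<omega> * V \<omega> > exp t} \<longrightarrow>
            \<omega> \<in> {\<omega>\<in>space M. U \<omega> * V \<omega> > exp t \<and> exp K < V \<omega> \<and> V \<omega> \<le> exp (t - K)} \<union>
            {\<omega>\<in>space M. U \<omega> > exp (t - K)} \<union> {\<omega>\<in>space M. V \<omega> > exp (t - K)}"
          using pos
        proof eventually_elim
          case (elim \<omega>)
          have "U \<omega> > exp (t - K)" if "U \<omega> * V \<omega> > exp t" "V \<omega> \<le> exp K"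
          proof -
            have "U \<omega> > 0" using that(1) elim by (smt (verit) exp_gt_zero zero_less_mult_pos2)
            then have "U \<omega> * V \<omega> \<le> U \<omega> * exp K" using that by (intro mult_left_mono) auto
            with that(1) have "exp t < U \<omega> * exp K" by simp
            then show ?thesis by (simp add: exp_diff pos_divide_less_eq)
          qed
          then show ?case by (cases "V \<omega> \<le> exp K") auto
        qed
      qed measurable
      also have "\<dots> \<le> ?m + \<P>(\<omega> in M. U \<omega> > exp (t - K)) + \<P>(\<omega> in M. V \<omega> > exp (t - K))"
        by (intro order_trans[OF measure_Un_le] add_mono measure_Un_le order_refl) measurable
      finally have "exp (\<alpha> * t) * \<P>(\<omega> in M. U \<omega> * V \<omega> > exp t) \<le>
          exp (\<alpha> * t) * (?m + \<P>(\<omega> in M. U \<omega> > exp (t - K)) + \<P>(\<omega> in M. V \<omega> > exp (t - K)))"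
        by (intro mult_left_mono) auto
      moreover have "exp (\<alpha> * t) * ?m \<le> c * J (K - h) t"
        unfolding J_def using c(1) \<alpha>
        by (intro scaled_tail_product_upper[OF ind h(1)] K\<^sub>1) (auto simp: K_def)
      moreover have "exp (\<alpha> * t) = exp (\<alpha> * K) * exp (\<alpha> * (t - K))"
        by (simp add: algebra_simps flip: exp_add)
      ultimately show ?thesis
        by (simp add: scaled_tail_def algebra_simps)
    qed
    have "((\<lambda>t. c * (J (K - h) t / D t) + exp (\<alpha> * K) * ?A (t - K) / D t + exp (\<alpha> * K) * ?B (t - K) / D t)
        \<longlongrightarrow> c * Beta a b + 0 + 0) at_top"
      using K_def by (intro tendsto_intros small_A small_B K\<^sub>0(2)) auto
    then have "\<forall>\<^sub>F t in at_top. c * (J (K - h) t / D t) + exp (\<alpha> * K) * ?A (t - K) / D t +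
        exp (\<alpha> * K) * ?B (t - K) / D t < y"
      using cy by (intro order_tendstoD) auto
    with D_pos show ?thesis
    proof eventually_elim
      case (elim t)
      have "?L t / D t \<le> (c * J (K - h) t + exp (\<alpha> * K) * ?A (t - K) + exp (\<alpha> * K) * ?B (t - K)) / D t"
        using bound elim by (intro divide_right_mono) auto
      also have "\<dots> < y" using elim by (simp add: add_divide_distrib)
      finally show ?case .
    qed
  qed
  have lower: "\<forall>\<^sub>F t in at_top. y < ?L t / D t" if y: "y < \<alpha> * Beta a b" for y
  proof (cases "y < 0")
    case True
    from D_pos show ?thesis
      by eventually_elim (use True in \<open>auto intro!: less_le_trans[OF _ divide_nonneg_nonneg] simp: scaled_tail_nonneg\<close>)
  next
    case False
    have "\<alpha> > y / Beta a b" using y Beta by (simp add: field_simps)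
    then obtain c where c: "c < \<alpha>" "y / Beta a b < c" using dense by blast
    have cy: "y < c * Beta a b" using c(2) Beta by (simp add: field_simps)
    \<comment> \<open>The lower convolution bound asks for a nonnegative constant. This is why
      negative \<open>y\<close>, which lie below the nonnegative ratio anyway, were treated
      separately.\<close>
    have c0: "c \<ge> 0" using False Beta c(2) by (meson divide_nonneg_pos linorder_not_less order_trans less_imp_le)
    have "((\<lambda>h. (1 - exp (- \<alpha> * h)) / h) \<longlongrightarrow> \<alpha>) (at_right 0)" by real_asymp
    from order_tendstoD(1)[OF this c(1)]
    have "\<forall>\<^sub>F h in at_right 0. c < (1 - exp (- \<alpha> * h)) / h \<and> h > 0"
      by (auto simp: eventually_conj_iff eventually_at_right_less)
    then obtain h where h: "h > 0" "c < (1 - exp (- \<alpha> * h)) / h"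
      using eventually_happens[of _ "at_right (0 :: real)"] by (auto simp: trivial_limit_at_right_real)
    have "((\<lambda>s. 1 - exp (- \<alpha> * h) * (?B (s + h) / ?B s)) \<longlongrightarrow> 1 - exp (- \<alpha> * h) * 1) at_top"
      by (intro tendsto_intros regularly_varying_shift[OF B])
    moreover have "c * h < 1 - exp (- \<alpha> * h) * 1" using h by (simp add: field_simps)
    ultimately have "\<forall>\<^sub>F s in at_top. c * h < 1 - exp (- \<alpha> * h) * (?B (s + h) / ?B s)"
      by (rule order_tendstoD)
    with B_pos have "\<forall>\<^sub>F s in at_top. c * h * ?B s \<le> ?B s - exp (- \<alpha> * h) * ?B (s + h)"
      by eventually_elim (simp add: field_simps)
    then obtain K\<^sub>1 where K\<^sub>1: "\<And>s. s \<ge> K\<^sub>1 \<Longrightarrow> c * h * ?B s \<le> ?B s - exp (- \<alpha> * h) * ?B (s + h)"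
      by (auto simp: eventually_at_top_linorder)
    define K where "K = max K\<^sub>1 K\<^sub>0"
    have bound: "c * J K t \<le> ?L t" for t
      unfolding J_def by (intro scaled_tail_product_lower[OF ind h(1) c0] K\<^sub>1) (auto simp: K_def)
    have "((\<lambda>t. c * (J K t / D t)) \<longlongrightarrow> c * Beta a b) at_top"
      using K_def by (intro tendsto_intros K\<^sub>0(2)) auto
    then have "\<forall>\<^sub>F t in at_top. y < c * (J K t / D t)"
      using cy by (intro order_tendstoD) auto
    with D_pos show ?thesis
    proof eventually_elim
      case (elim t)
      have "y < c * J K t / D t" using elim by simp
      also have "\<dots> \<le> ?L t / D t"
        using bound elim by (intro divide_right_mono) auto
      finally show ?case .
    qed
  qed
  show ?thesis
    using order_tendstoI[OF lower upper] by (simp add: D_def)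
qed


section \<open>Adding an independent variable with a lighter tail\<close>

lemma scaled_tail_shift: "exp (\<alpha> * t) * \<P>(\<omega> in M. V \<omega> > exp (t - h)) = exp (\<alpha> * h) * scaled_tail \<alpha> V (t - h)"
  by (simp add: scaled_tail_def algebra_simps flip: exp_add mult.assoc)

lemma prob_greater_eq_cdf:
  fixes X :: "'a \<Rightarrow> real"
  assumes [measurable]: "random_variable borel X"
  shows "\<P>(\<omega> in M. X \<omega> > x) = 1 - cdf (distr M borel X) x"
proof -
  have "\<P>(\<omega> in M. X \<omega> > x) = \<P>(\<omega> in M. \<not> X \<omega> \<le> x)" by (simp add: not_le)
  also have "\<dots> = 1 - \<P>(\<omega> in M. X \<omega> \<le> x)" by (rule prob_neg) measurable
  also have "\<P>(\<omega> in M. X \<omega> \<le> x) = cdf (distr M borel X) x"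
    by (simp add: cdf_def measure_distr vimage_def Int_def conj_commute)
  finally show ?thesis .
qed

lemma tendsto_prob_greater_at_bot:
  fixes X :: "'a \<Rightarrow> real"
  assumes [measurable]: "random_variable borel X"
  shows "((\<lambda>x. \<P>(\<omega> in M. X \<omega> > x)) \<longlongrightarrow> 1) at_bot"
proof -
  interpret D: real_distribution "distr M borel X" by simp
  have "((\<lambda>x. 1 - cdf (distr M borel X) x) \<longlongrightarrow> 1 - 0) at_bot"
    by (intro tendsto_intros D.cdf_lim_at_bot)
  then show ?thesis by (simp add: prob_greater_eq_cdf[OF assms])
qed

text \<open>The principle of one big jump. A large sum needs \<open>V\<close> nearly as large, or
  \<open>X\<close> nearly as large, or both of comparable size. The second case is negligible by
  \<open>negl\<close>, the third by independence. Conversely a slightly larger \<open>V\<close>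
  suffices unless \<open>X\<close> is very negative, which has vanishing probability. The slack is a
  factor \<open>exp h\<close> in the threshold; it changes the tail of \<open>V\<close> by about
  \<open>exp (\<alpha> * h)\<close>, and \<open>h\<close> is arbitrarily small.\<close>

lemma tendsto_scaled_tail_add:
  fixes X V :: "'a \<Rightarrow> real"
  assumes ind: "indep_var borel X borel V" and \<alpha>: "\<alpha> > 0"
    and B: "regularly_varying (scaled_tail \<alpha> V) r"
    and negl: "((\<lambda>t. scaled_tail \<alpha> X t / scaled_tail \<alpha> V t) \<longlongrightarrow> 0) at_top"
  shows "((\<lambda>t. scaled_tail \<alpha> (\<lambda>\<omega>. X \<omega> + V \<omega>) t / scaled_tail \<alpha> V t) \<longlongrightarrow> 1) at_top"
proof -
  note rv[measurable] = indep_var_rv1[OF ind] indep_var_rv2[OF ind]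
  let ?A = "scaled_tail \<alpha> X" and ?B = "scaled_tail \<alpha> V" and ?L = "scaled_tail \<alpha> (\<lambda>\<omega>. X \<omega> + V \<omega>)"
  have B_pos: "\<forall>\<^sub>F t in at_top. ?B t > 0" by (rule regularly_varyingD(2)[OF B])
  have shift: "filterlim (\<lambda>t. t - k) at_top at_top" for k :: real by real_asymp
  have B_shift: "((\<lambda>t. ?B (t - k) / ?B t) \<longlongrightarrow> 1) at_top" for k
    using regularly_varying_shift[OF B, of "- k"] by simp
  have A_shift: "((\<lambda>t. ?A (t - k) / ?B t) \<longlongrightarrow> 0) at_top" for k
  proof -
    have "((\<lambda>t. ?A (t - k) / ?B (t - k) * (?B (t - k) / ?B t)) \<longlongrightarrow> 0 * 1) at_top"
      by (intro tendsto_mult B_shift filterlim_compose[OF negl shift])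
    moreover have "\<forall>\<^sub>F t in at_top. ?A (t - k) / ?B (t - k) * (?B (t - k) / ?B t) = ?A (t - k) / ?B t"
      using eventually_compose_filterlim[OF B_pos shift[of k]] by eventually_elim simp
    ultimately show ?thesis by (auto intro: Lim_transform_eventually)
  qed
  have X_tail: "((\<lambda>t. \<P>(\<omega> in M. X \<omega> > exp (t - k))) \<longlongrightarrow> 0) at_top" for k
  proof -
    have "((\<lambda>t. \<P>(\<omega> in M. X \<omega> > exp t)) \<longlongrightarrow> 0) at_top"
    proof (rule tendsto_sandwich[OF _ _ tendsto_const negl])
      show "\<forall>\<^sub>F t in at_top. \<P>(\<omega> in M. X \<omega> > exp t) \<le> ?A t / ?B t"
        using B_pos
      proof eventually_elim
        case (elim t)
        have "\<P>(\<omega> in M. X \<omega> > exp t) * ?B t \<le> ?A t"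
          unfolding scaled_tail_def
          by (simp add: mult.left_commute mult_left_le mult_left_le_one_le)
        with elim show ?case by (simp add: pos_le_divide_eq)
      qed
    qed simp
    from filterlim_compose[OF this shift] show ?thesis .
  qed
  have upper: "\<forall>\<^sub>F t in at_top. ?L t / ?B t < y" if y: "y > 1" for y
  proof -
    have "((\<lambda>h. exp (\<alpha> * h)) \<longlongrightarrow> 1) (at_right 0)" by real_asymp
    from order_tendstoD(2)[OF this y]
    have "\<forall>\<^sub>F h in at_right 0. exp (\<alpha> * h) < y \<and> h > 0"
      by (auto simp: eventually_conj_iff eventually_at_right_less)
    then obtain h where h: "h > 0" "exp (\<alpha> * h) < y"
      using eventually_happens[of _ "at_right (0 :: real)"] by (auto simp: trivial_limit_at_right_real)
    \<comment> \<open>Chosen so that \<open>exp t\<close> is the sum of \<open>exp (t - h)\<close>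
      and \<open>exp (t - k)\<close>: if one of the two variables is at most
      \<open>exp (t - h)\<close>, the other must exceed \<open>exp (t - k)\<close>.\<close>
    define k where "k = - ln (1 - exp (- h))"
    have k: "exp (t - k) = exp t - exp (t - h)" for t
      using h by (simp add: k_def exp_add exp_diff exp_minus field_simps)
    have bound: "?L t \<le> exp (\<alpha> * h) * ?B (t - h) + exp (\<alpha> * h) * ?A (t - h) +
        exp (\<alpha> * k) * ?B (t - k) * \<P>(\<omega> in M. X \<omega> > exp (t - k))" for t
    proof -
      have "\<P>(\<omega> in M. X \<omega> + V \<omega> > exp t) \<le> prob ({\<omega>\<in>space M. V \<omega> > exp (t - h)} \<union>
          {\<omega>\<in>space M. X \<omega> > exp (t - h)} \<union> {\<omega>\<in>space M. X \<omega> > exp (t - k) \<and> V \<omega> > exp (t - k)})"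
      proof (rule finite_measure_mono)
        show "{\<omega>\<in>space M. X \<omega> + V \<omega> > exp t} \<subseteq> {\<omega>\<in>space M. V \<omega> > exp (t - h)} \<union>
          {\<omega>\<in>space M. X \<omega> > exp (t - h)} \<union> {\<omega>\<in>space M. X \<omega> > exp (t - k) \<and> V \<omega> > exp (t - k)}"
          by (auto simp: k)
      qed measurable
      also have "\<dots> \<le> \<P>(\<omega> in M. V \<omega> > exp (t - h)) + \<P>(\<omega> in M. X \<omega> > exp (t - h)) +
          \<P>(\<omega> in M. X \<omega> > exp (t - k) \<and> V \<omega> > exp (t - k))"
        by (intro order_trans[OF measure_Un_le] add_mono measure_Un_le order_refl) measurable
      also have "\<P>(\<omega> in M. X \<omega> > exp (t - k) \<and> V \<omega> > exp (t - k)) =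
          \<P>(\<omega> in M. X \<omega> > exp (t - k)) * \<P>(\<omega> in M. V \<omega> > exp (t - k))"
        by (intro indep_var_prob_conj[OF ind]) measurable
      finally have "?L t \<le> exp (\<alpha> * t) * (\<P>(\<omega> in M. V \<omega> > exp (t - h)) + \<P>(\<omega> in M. X \<omega> > exp (t - h)) +
          \<P>(\<omega> in M. X \<omega> > exp (t - k)) * \<P>(\<omega> in M. V \<omega> > exp (t - k)))"
        unfolding scaled_tail_def by (intro mult_left_mono) auto
      also have "\<dots> = exp (\<alpha> * t) * \<P>(\<omega> in M. V \<omega> > exp (t - h)) + exp (\<alpha> * t) * \<P>(\<omega> in M. X \<omega> > exp (t - h)) +
          exp (\<alpha> * t) * \<P>(\<omega> in M. V \<omega> > exp (t - k)) * \<P>(\<omega> in M. X \<omega> > exp (t - k))"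
        by (simp only: distrib_left mult_ac)
      finally show ?thesis unfolding scaled_tail_shift .
    qed
    have "((\<lambda>t. exp (\<alpha> * h) * (?B (t - h) / ?B t) + exp (\<alpha> * h) * (?A (t - h) / ?B t) +
        exp (\<alpha> * k) * (?B (t - k) / ?B t) * \<P>(\<omega> in M. X \<omega> > exp (t - k)))
        \<longlongrightarrow> exp (\<alpha> * h) * 1 + exp (\<alpha> * h) * 0 + exp (\<alpha> * k) * 1 * 0) at_top"
      by (intro tendsto_add tendsto_mult tendsto_const B_shift A_shift X_tail)
    then have "\<forall>\<^sub>F t in at_top. exp (\<alpha> * h) * (?B (t - h) / ?B t) + exp (\<alpha> * h) * (?A (t - h) / ?B t) +
        exp (\<alpha> * k) * (?B (t - k) / ?B t) * \<P>(\<omega> in M. X \<omega> > exp (t - k)) < y"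
      using h by (intro order_tendstoD) auto
    with B_pos show ?thesis
    proof eventually_elim
      case (elim t)
      have "?L t / ?B t \<le> (exp (\<alpha> * h) * ?B (t - h) + exp (\<alpha> * h) * ?A (t - h) +
          exp (\<alpha> * k) * ?B (t - k) * \<P>(\<omega> in M. X \<omega> > exp (t - k))) / ?B t"
        using bound elim by (intro divide_right_mono) auto
      also have "\<dots> < y" using elim by (simp add: add_divide_distrib)
      finally show ?case .
    qed
  qed
  have lower: "\<forall>\<^sub>F t in at_top. y < ?L t / ?B t" if y: "y < 1" for y
  proof -
    have "((\<lambda>h. exp (- \<alpha> * h)) \<longlongrightarrow> 1) (at_right 0)" by real_asymp
    from order_tendstoD(1)[OF this y]
    have "\<forall>\<^sub>F h in at_right 0. y < exp (- \<alpha> * h) \<and> h > 0"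
      by (auto simp: eventually_conj_iff eventually_at_right_less)
    then obtain h where h: "h > 0" "y < exp (- \<alpha> * h)"
      using eventually_happens[of _ "at_right (0 :: real)"] by (auto simp: trivial_limit_at_right_real)
    \<comment> \<open>The most negative value of \<open>X\<close> that a value of \<open>V\<close>
      above \<open>exp (t + h)\<close> can compensate. It tends to minus infinity because
      \<open>h > 0\<close>, so requiring \<open>X\<close> to exceed it costs nothing in the
      limit.\<close>
    define z where "z t = exp t - exp (t + h)" for t
    have "filterlim z at_bot at_top"
      unfolding z_def using h by real_asymp
    then have X_lim: "((\<lambda>t. \<P>(\<omega> in M. X \<omega> > z t)) \<longlongrightarrow> 1) at_top"
      by (rule filterlim_compose[OF tendsto_prob_greater_at_bot[OF rv(1)]])
    have bound: "exp (- \<alpha> * h) * ?B (t + h) * \<P>(\<omega> in M. X \<omega> > z t) \<le> ?L t" for t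
    proof -
      have "\<P>(\<omega> in M. X \<omega> > z t) * \<P>(\<omega> in M. V \<omega> > exp (t + h)) =
          \<P>(\<omega> in M. X \<omega> > z t \<and> V \<omega> > exp (t + h))"
        by (intro indep_var_prob_conj[OF ind, symmetric]) measurable
      also have "\<dots> \<le> \<P>(\<omega> in M. X \<omega> + V \<omega> > exp t)"
      proof (rule finite_measure_mono)
        show "{\<omega>\<in>space M. X \<omega> > z t \<and> V \<omega> > exp (t + h)} \<subseteq> {\<omega>\<in>space M. X \<omega> + V \<omega> > exp t}"
          by (auto simp: z_def)
      qed measurable
      finally have "exp (\<alpha> * t) * (\<P>(\<omega> in M. X \<omega> > z t) * \<P>(\<omega> in M. V \<omega> > exp (t + h))) \<le> ?L t"
        unfolding scaled_tail_def by (intro mult_left_mono) auto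
      moreover have "exp (\<alpha> * t) * (\<P>(\<omega> in M. X \<omega> > z t) * \<P>(\<omega> in M. V \<omega> > exp (t + h))) =
          exp (- \<alpha> * h) * ?B (t + h) * \<P>(\<omega> in M. X \<omega> > z t)"
        using scaled_tail_shift[where V = V and h = "- h" and t = t and \<alpha> = \<alpha>] by (simp add: mult_ac)
      ultimately show ?thesis by simp
    qed
    have "((\<lambda>t. exp (- \<alpha> * h) * (?B (t + h) / ?B t) * \<P>(\<omega> in M. X \<omega> > z t)) \<longlongrightarrow> exp (- \<alpha> * h) * 1 * 1) at_top"
      by (intro tendsto_mult tendsto_const regularly_varying_shift[OF B] X_lim)
    then have "\<forall>\<^sub>F t in at_top. y < exp (- \<alpha> * h) * (?B (t + h) / ?B t) * \<P>(\<omega> in M. X \<omega> > z t)"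
      using h by (intro order_tendstoD) auto
    with B_pos show ?thesis
    proof eventually_elim
      case (elim t)
      have "y < (exp (- \<alpha> * h) * ?B (t + h) * \<P>(\<omega> in M. X \<omega> > z t)) / ?B t" using elim by simp
      also have "\<dots> \<le> ?L t / ?B t"
        using bound elim by (intro divide_right_mono) auto
      finally show ?case .
    qed
  qed
  show ?thesis by (rule order_tendstoI[OF lower upper])
qed

end

section \<open>Discounted sums and independence of their parts\<close>

text \<open>The offset \<open>i\<close> stands just before the first index used, and
  \<open>m\<close> counts the summands. The arguments are plain real sequences so that the same
  expression can be read both at an outcome and on the coordinates of a product space.\<close>

primrec discounted_sum :: "(nat \<Rightarrow> real) \<Rightarrow> (nat \<Rightarrow> real) \<Rightarrow> nat \<Rightarrow> nat \<Rightarrow> real" where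
  "discounted_sum x y i 0 = 0"
| "discounted_sum x y i (Suc m) = y (Suc i) * (x (Suc i) + discounted_sum x y (Suc i) m)"

text \<open>Locality above \<open>i\<close> lets the sum be evaluated on a family restricted to
  later coordinates, as independence of disjoint blocks requires.\<close>

lemma discounted_sum_cong:
  assumes "\<And>j. j > i \<Longrightarrow> x j = x' j" "\<And>j. j > i \<Longrightarrow> y j = y' j"
  shows "discounted_sum x y i m = discounted_sum x' y' i m"
  using assms
proof (induction m arbitrary: i)
  case (Suc m)
  have "discounted_sum x y (Suc i) m = discounted_sum x' y' (Suc i) m"
    by (rule Suc.IH) (use Suc.prems in auto)
  then show ?case using Suc.prems by simp
qed simp

lemma discounted_sum_eq:
  "discounted_sum x y i m = (\<Sum>k=1..m. x (i + k) * (\<Prod>j=1..k. y (i + j)))"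
proof (induction m arbitrary: i)
  case (Suc m)
  have ivl: "{1..Suc m} = insert 1 (Suc ` {1..m})" for m
    by (simp add: image_Suc_atLeastAtMost atLeastAtMost_insertL)
  have sum_split: "(\<Sum>k=1..Suc m. x (i + k) * (\<Prod>j=1..k. y (i + j))) =
      x (Suc i) * y (Suc i) + (\<Sum>k=1..m. x (i + Suc k) * (\<Prod>j=1..Suc k. y (i + j)))"
    unfolding ivl[of m] by (subst sum.insert) (auto simp: sum.reindex simp del: image_Suc_atLeastAtMost prod.cl_ivl_Suc)
  have prod_split: "(\<Prod>j=1..Suc k. y (i + j)) = y (Suc i) * (\<Prod>j=1..k. y (Suc i + j))" for k
    unfolding ivl[of k] by (subst prod.insert) (auto simp: prod.reindex simp del: image_Suc_atLeastAtMost)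
  show ?case
    unfolding discounted_sum.simps Suc sum_split prod_split
    by (simp add: algebra_simps sum_distrib_left)
qed simp

lemma measurable_discounted_sum:
  assumes "\<And>j. j > i \<Longrightarrow> Inl j \<in> B" "\<And>j. j > i \<Longrightarrow> Inr j \<in> B"
  shows "(\<lambda>w. discounted_sum (\<lambda>j. w (Inl j)) (\<lambda>j. w (Inr j)) i m) \<in>
    borel_measurable (Pi\<^sub>M B (\<lambda>_. borel))"
  using assms
proof (induction m arbitrary: i)
  case (Suc m)
  have "(\<lambda>w. discounted_sum (\<lambda>j. w (Inl j)) (\<lambda>j. w (Inr j)) (Suc i) m) \<in>
      borel_measurable (Pi\<^sub>M B (\<lambda>_. borel))"
    by (rule Suc.IH) (use Suc.prems in auto)
  moreover have "(\<lambda>w. w (Inl (Suc i))) \<in> borel_measurable (Pi\<^sub>M B (\<lambda>_. borel))"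
    "(\<lambda>w. w (Inr (Suc i))) \<in> borel_measurable (Pi\<^sub>M B (\<lambda>_. borel))"
    using Suc.prems by (auto intro!: measurable_component_singleton)
  ultimately show ?case
    unfolding discounted_sum.simps by (intro borel_measurable_times borel_measurable_add)
qed simp

context prob_space
begin

text \<open>Block independence speaks of restricted families, the points of the product spaces. The
  invariance hypotheses on \<open>f\<close> and \<open>g\<close> remove the restrictions, so the
  result can be read with the original variables.\<close>

lemma indep_var_restrict_fun:
  fixes f g :: "('i \<Rightarrow> real) \<Rightarrow> real"
  assumes ind: "indep_vars (\<lambda>_. borel) W I" and AB: "A \<inter> B = {}" "A \<subseteq> I" "B \<subseteq> I"
    and meas: "f \<in> borel_measurable (Pi\<^sub>M A (\<lambda>_. borel))" "g \<in> borel_measurable (Pi\<^sub>M B (\<lambda>_. borel))"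
    and f: "\<And>w. f (restrict w A) = f w" and g: "\<And>w. g (restrict w B) = g w"
  shows "indep_var borel (\<lambda>\<omega>. f (\<lambda>i. W i \<omega>)) borel (\<lambda>\<omega>. g (\<lambda>i. W i \<omega>))"
  using indep_var_compose[OF indep_var_restrict[OF ind AB] meas] by (simp add: o_def f g)

lemma prob_indep_vars_Ball:
  assumes X: "indep_vars N X I" and J: "finite J" "J \<subseteq> I" "\<And>i. i \<in> J \<Longrightarrow> A i \<in> sets (N i)"
  shows "\<P>(\<omega> in M. \<forall>i\<in>J. X i \<omega> \<in> A i) = (\<Prod>i\<in>J. \<P>(\<omega> in M. X i \<omega> \<in> A i))"
proof (cases "J = {}")
  case False
  have *: "{\<omega>\<in>space M. X i \<omega> \<in> A i} = X i -` A i \<inter> space M" for i by auto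
  have "{\<omega>\<in>space M. \<forall>i\<in>J. X i \<omega> \<in> A i} = (\<Inter>i\<in>J. X i -` A i \<inter> space M)"
    using False by auto
  with indep_varsD[OF X False J] show ?thesis by (simp add: *)
qed (simp add: prob_space)

text \<open>A finite set of indices splits into its left and right parts. Mutual independence
  factors the joint probability into one factor per part, and independence within each sequence
  factors these further.\<close>

lemma indep_vars_joint:
  fixes X Y :: "'i \<Rightarrow> 'a \<Rightarrow> real"
  assumes X: "indep_vars (\<lambda>_. borel) X I" and Y: "indep_vars (\<lambda>_. borel) Y J"
    and XY: "indep_var (Pi\<^sub>M I (\<lambda>_. borel)) (\<lambda>\<omega>. \<lambda>i\<in>I. X i \<omega>) (Pi\<^sub>M J (\<lambda>_. borel)) (\<lambda>\<omega>. \<lambda>j\<in>J. Y j \<omega>)"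
  shows "indep_vars (\<lambda>_. borel) (case_sum X Y) (I <+> J)"
  unfolding indep_vars_def2
proof (intro conjI ballI)
  have meas: "\<And>i. i \<in> I \<Longrightarrow> random_variable borel (X i)" "\<And>j. j \<in> J \<Longrightarrow> random_variable borel (Y j)"
    using X Y by (auto simp: indep_vars_def2)
  then show rv: "random_variable borel (case_sum X Y k)" if "k \<in> I <+> J" for k
    using that by auto
  let ?G = "\<lambda>k. {case_sum X Y k -` A \<inter> space M |A. A \<in> sets borel}"
  show "indep_sets ?G (I <+> J)"
  proof (rule indep_setsI)
    fix k assume "k \<in> I <+> J"
    then show "?G k \<subseteq> events" using measurable_sets[OF rv] by auto
  next
    fix C K assume K: "K \<noteq> {}" "K \<subseteq> I <+> J" "finite K" and "\<forall>k\<in>K. C k \<in> ?G k"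
    then have "\<forall>k\<in>K. \<exists>A. A \<in> sets borel \<and> C k = case_sum X Y k -` A \<inter> space M" by auto
    then obtain A where A: "\<And>k. k \<in> K \<Longrightarrow> A k \<in> sets borel"
      "\<And>k. k \<in> K \<Longrightarrow> C k = case_sum X Y k -` A k \<inter> space M" by metis
    define KI where "KI = Inl -` K"
    define KJ where "KJ = Inr -` K"
    have KIJ: "K = Inl ` KI \<union> Inr ` KJ"
    proof (rule set_eqI)
      show "k \<in> K \<longleftrightarrow> k \<in> Inl ` KI \<union> Inr ` KJ" for k
        by (cases k) (auto simp: KI_def KJ_def)
    qed
    have sub: "KI \<subseteq> I" "KJ \<subseteq> J" using K(2) by (auto simp: KI_def KJ_def)
    have fin: "finite KI" "finite KJ"
      using K(3) by (auto simp: KI_def KJ_def intro!: finite_vimageI)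
    have AI: "A (Inl i) \<in> sets borel" if "i \<in> KI" for i using that A(1) by (simp add: KI_def)
    have AJ: "A (Inr j) \<in> sets borel" if "j \<in> KJ" for j using that A(1) by (simp add: KJ_def)
    have coord: "Measurable.pred (Pi\<^sub>M L (\<lambda>_. borel)) (\<lambda>w. w i \<in> S)"
      if "i \<in> L" "S \<in> sets borel" for i :: 'i and L and S :: "real set"
    proof -
      note [measurable] = that(2)
      have [measurable]: "(\<lambda>w. w i) \<in> borel_measurable (Pi\<^sub>M L (\<lambda>_. borel :: real measure))"
        by (rule measurable_component_singleton[OF that(1)])
      show ?thesis by measurable
    qed
    have C: "C k = {\<omega>\<in>space M. case_sum X Y k \<omega> \<in> A k}" if "k \<in> K" for k
      using A(2)[OF that] by auto
    have "(\<Inter>k\<in>K. C k) = {\<omega>\<in>space M. (\<forall>i\<in>KI. (\<lambda>i\<in>I. X i \<omega>) i \<in> A (Inl i)) \<and>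
        (\<forall>j\<in>KJ. (\<lambda>j\<in>J. Y j \<omega>) j \<in> A (Inr j))}"
    proof -
      have "(\<Inter>k\<in>K. C k) = {\<omega>\<in>space M. \<forall>k\<in>K. case_sum X Y k \<omega> \<in> A k}"
        using K(1) C by auto
      also have "\<dots> = {\<omega>\<in>space M. (\<forall>i\<in>KI. X i \<omega> \<in> A (Inl i)) \<and> (\<forall>j\<in>KJ. Y j \<omega> \<in> A (Inr j))}"
        unfolding KIJ by (simp add: ball_Un)
      also have "\<dots> = {\<omega>\<in>space M. (\<forall>i\<in>KI. (\<lambda>i\<in>I. X i \<omega>) i \<in> A (Inl i)) \<and>
          (\<forall>j\<in>KJ. (\<lambda>j\<in>J. Y j \<omega>) j \<in> A (Inr j))}"
        using sub by (intro Collect_cong conj_cong ball_cong refl) auto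
      finally show ?thesis .
    qed
    then have "prob (\<Inter>k\<in>K. C k) = \<P>(\<omega> in M. (\<forall>i\<in>KI. (\<lambda>i\<in>I. X i \<omega>) i \<in> A (Inl i)) \<and>
        (\<forall>j\<in>KJ. (\<lambda>j\<in>J. Y j \<omega>) j \<in> A (Inr j)))" by simp
    also have "\<dots> = \<P>(\<omega> in M. \<forall>i\<in>KI. (\<lambda>i\<in>I. X i \<omega>) i \<in> A (Inl i)) *
        \<P>(\<omega> in M. \<forall>j\<in>KJ. (\<lambda>j\<in>J. Y j \<omega>) j \<in> A (Inr j))"
      by (rule indep_var_prob_conj[OF XY]) (use sub AI AJ in \<open>auto intro!: pred_intros_finite(3) fin coord\<close>)
    also have "\<P>(\<omega> in M. \<forall>i\<in>KI. (\<lambda>i\<in>I. X i \<omega>) i \<in> A (Inl i)) = \<P>(\<omega> in M. \<forall>i\<in>KI. X i \<omega> \<in> A (Inl i))"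
      using sub by (intro arg_cong[where f = prob] Collect_cong conj_cong ball_cong refl) auto
    also have "\<dots> = (\<Prod>i\<in>KI. \<P>(\<omega> in M. X i \<omega> \<in> A (Inl i)))"
      by (rule prob_indep_vars_Ball[OF X fin(1) sub(1) AI])
    also have "\<P>(\<omega> in M. \<forall>j\<in>KJ. (\<lambda>j\<in>J. Y j \<omega>) j \<in> A (Inr j)) = \<P>(\<omega> in M. \<forall>j\<in>KJ. Y j \<omega> \<in> A (Inr j))"
      using sub by (intro arg_cong[where f = prob] Collect_cong conj_cong ball_cong refl) auto
    also have "\<dots> = (\<Prod>j\<in>KJ. \<P>(\<omega> in M. Y j \<omega> \<in> A (Inr j)))"
      by (rule prob_indep_vars_Ball[OF Y fin(2) sub(2) AJ])
    also have "(\<Prod>i\<in>KI. \<P>(\<omega> in M. X i \<omega> \<in> A (Inl i))) * \<dots> =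
        (\<Prod>k\<in>K. \<P>(\<omega> in M. case_sum X Y k \<omega> \<in> A k))"
      unfolding KIJ using fin by (subst prod.union_disjoint) (auto simp: prod.reindex)
    also have "\<dots> = (\<Prod>k\<in>K. prob (C k))"
      by (intro prod.cong refl) (simp add: C)
    finally show "prob (\<Inter>k\<in>K. C k) = (\<Prod>k\<in>K. prob (C k))" .
  qed
qed

end

section \<open>The tail of a discounted sum by backward induction\<close>

lemma regularly_varying_prod:
  assumes "finite J" "\<And>j. j \<in> J \<Longrightarrow> regularly_varying (f j) (r j)"
  shows "regularly_varying (\<lambda>t. \<Prod>j\<in>J. f j t) (\<Sum>j\<in>J. r j)"
  using assms
proof (induction J rule: finite_induct)
  case empty
  show ?case by (auto simp: regularly_varying_def)
next
  case (insert j J)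
  then show ?case using regularly_varying_mult[of "f j" "r j"] by simp
qed

text \<open>Each multiplication by some \<open>Y j\<close> raises the index by
  \<open>\<gamma> j\<close>, while the addition before it leaves the tail unchanged to first order.
  The summands before the last enter through negligibility against functions of larger index rather
  than through an index of their own, so that variables with vanishing tail may stand there.\<close>

lemma (in prob_space) tendsto_scaled_tail_discounted_sum:
  fixes Z Y :: "nat \<Rightarrow> 'a \<Rightarrow> real"
  assumes ind: "indep_vars (\<lambda>_. borel) (case_sum Z Y) ({1..} <+> {1..})"
    and pos: "\<And>i. i \<ge> 1 \<Longrightarrow> AE \<omega> in M. Y i \<omega> > 0"
    and \<alpha>: "\<alpha> > 0" and \<gamma>s: "\<gamma>s > 0" and \<gamma>: "\<And>i. i \<ge> 1 \<Longrightarrow> \<gamma> i > 0"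
    and Y: "\<And>i. i \<ge> 1 \<Longrightarrow> regularly_varying (scaled_tail \<alpha> (Y i)) (\<gamma> i - 1)"
    and Z: "regularly_varying (scaled_tail \<alpha> (Z n)) (\<gamma>s - 1)"
    and negl: "\<And>i f r. 1 \<le> i \<Longrightarrow> i < n \<Longrightarrow> regularly_varying f r \<Longrightarrow> \<gamma>s - 1 < r \<Longrightarrow>
      ((\<lambda>t. scaled_tail \<alpha> (Z i) t / f t) \<longlongrightarrow> 0) at_top"
    and n: "i + Suc m = n"
  shows "((\<lambda>t. scaled_tail \<alpha> (\<lambda>\<omega>. discounted_sum (\<lambda>j. Z j \<omega>) (\<lambda>j. Y j \<omega>) i (Suc m)) t /
      (scaled_tail \<alpha> (Z n) t * (\<Prod>j\<in>{Suc i..n}. t * scaled_tail \<alpha> (Y j) t))) \<longlongrightarrow>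
    \<alpha> ^ Suc m * (Gamma \<gamma>s * (\<Prod>j\<in>{Suc i..n}. Gamma (\<gamma> j)) / Gamma (\<gamma>s + (\<Sum>j\<in>{Suc i..n}. \<gamma> j)))) at_top"
proof -
  \<comment> \<open>For \<open>i + m = n\<close>, \<open>d i m\<close> is the remaining sum after
    index \<open>i\<close>. \<open>R i\<close> is its predicted size up to a constant and has index
    \<open>a i - 1\<close>; \<open>C i\<close> is the constant without its power of
    \<open>\<alpha>\<close>.\<close>
  define d where "d i m \<omega> = discounted_sum (\<lambda>j. Z j \<omega>) (\<lambda>j. Y j \<omega>) i m" for i m \<omega>
  define a where "a i = \<gamma>s + (\<Sum>j\<in>{Suc i..n}. \<gamma> j)" for i
  define R where "R i t = scaled_tail \<alpha> (Z n) t * (\<Prod>j\<in>{Suc i..n}. t * scaled_tail \<alpha> (Y j) t)" for i t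
  define C where "C i = Gamma \<gamma>s * (\<Prod>j\<in>{Suc i..n}. Gamma (\<gamma> j)) / Gamma (a i)" for i
  have a_pos: "a i > 0" for i
    unfolding a_def using \<gamma>s \<gamma> by (intro add_pos_nonneg sum_nonneg) (auto intro: less_imp_le)
  have C_pos: "C i > 0" for i
    unfolding C_def using a_pos \<gamma>s \<gamma> by (intro divide_pos_pos mult_pos_pos prod_pos) (auto simp: Gamma_real_pos)
  have R_rv: "regularly_varying (R i) (a i - 1)" for i
  proof -
    have "regularly_varying (R i) (\<gamma>s - 1 + (\<Sum>j\<in>{Suc i..n}. 1 + (\<gamma> j - 1)))"
      unfolding R_def
      by (intro regularly_varying_mult regularly_varying_prod regularly_varying_ident Y Z) auto
    also have "\<gamma>s - 1 + (\<Sum>j\<in>{Suc i..n}. 1 + (\<gamma> j - 1)) = a i - 1" by (simp add: a_def)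
    finally show ?thesis .
  qed
  have meas: "(\<lambda>w. w (Inl (Suc i)) + discounted_sum (\<lambda>j. w (Inl j)) (\<lambda>j. w (Inr j)) (Suc i) m) \<in>
      borel_measurable (Pi\<^sub>M (Inl ` {Suc i..} \<union> Inr ` {Suc (Suc i)..}) (\<lambda>_. borel))" for i m
    by (intro borel_measurable_add measurable_discounted_sum measurable_component_singleton) auto
  have indU: "indep_var borel (\<lambda>\<omega>. Z (Suc i) \<omega> + d (Suc i) m \<omega>) borel (Y (Suc i))" for i m
  proof -
    have "indep_var borel (\<lambda>\<omega>. case_sum Z Y (Inl (Suc i)) \<omega> +
        discounted_sum (\<lambda>j. case_sum Z Y (Inl j) \<omega>) (\<lambda>j. case_sum Z Y (Inr j) \<omega>) (Suc i) m)
      borel (\<lambda>\<omega>. case_sum Z Y (Inr (Suc i)) \<omega>)"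
      by (rule indep_var_restrict_fun[OF ind _ _ _ meas[of i m],
            where B = "{Inr (Suc i)}" and g = "\<lambda>w. w (Inr (Suc i))"])
         (auto intro!: arg_cong2[where f = "(+)"] discounted_sum_cong measurable_component_singleton)
    then show ?thesis by (simp add: d_def)
  qed
  have indZ: "indep_var borel (Z (Suc i)) borel (d (Suc i) m)" for i m
  proof -
    have "indep_var borel (\<lambda>\<omega>. case_sum Z Y (Inl (Suc i)) \<omega>)
      borel (\<lambda>\<omega>. discounted_sum (\<lambda>j. case_sum Z Y (Inl j) \<omega>) (\<lambda>j. case_sum Z Y (Inr j) \<omega>) (Suc i) m)"
      by (rule indep_var_restrict_fun[OF ind, where A = "{Inl (Suc i)}"
            and B = "Inl ` {Suc (Suc i)..} \<union> Inr ` {Suc (Suc i)..}"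
            and f = "\<lambda>w. w (Inl (Suc i))"
            and g = "\<lambda>w. discounted_sum (\<lambda>j. w (Inl j)) (\<lambda>j. w (Inr j)) (Suc i) m"])
         (auto intro!: discounted_sum_cong measurable_component_singleton measurable_discounted_sum)
    then show ?thesis by (simp add: d_def[abs_def])
  qed
  \<comment> \<open>The multiplication by \<open>Y (Suc i)\<close>, common to the innermost bracket
    and to the later ones. They differ only in how the bracket itself is estimated.\<close>
  have step: "((\<lambda>t. scaled_tail \<alpha> (d i (Suc m)) t / R i t) \<longlongrightarrow> \<alpha> ^ Suc m * C i) at_top"
    if U: "((\<lambda>t. scaled_tail \<alpha> (\<lambda>\<omega>. Z (Suc i) \<omega> + d (Suc i) m \<omega>) t / R (Suc i) t) \<longlongrightarrow> \<alpha> ^ m * C (Suc i)) at_top"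
      and i: "Suc i \<le> n" for i m
  proof -
    let ?U = "\<lambda>\<omega>. Z (Suc i) \<omega> + d (Suc i) m \<omega>"
    have U_rv: "regularly_varying (scaled_tail \<alpha> ?U) (a (Suc i) - 1)"
      by (rule regularly_varying_equivI[OF _ regularly_varyingD(2)[OF R_rv] regularly_varyingD(3)[OF R_rv] U])
         (use \<alpha> C_pos indep_var_rv1[OF indU] in \<open>auto intro!: borel_measurable_scaled_tail\<close>)
    have d_eq: "d i (Suc m) = (\<lambda>\<omega>. ?U \<omega> * Y (Suc i) \<omega>)"
      by (simp add: d_def fun_eq_iff)
    have split: "{Suc i..n} = insert (Suc i) {Suc (Suc i)..n}" using i by auto
    have R_eq: "R i t = t * scaled_tail \<alpha> (Y (Suc i)) t * R (Suc i) t" for t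
      unfolding R_def split by simp
    have a_eq: "a i = a (Suc i) + \<gamma> (Suc i)" unfolding a_def split by simp
    have lim: "((\<lambda>t. scaled_tail \<alpha> (d i (Suc m)) t / (t * scaled_tail \<alpha> ?U t * scaled_tail \<alpha> (Y (Suc i)) t) *
        (scaled_tail \<alpha> ?U t / R (Suc i) t)) \<longlongrightarrow> \<alpha> * Beta (a (Suc i)) (\<gamma> (Suc i)) * (\<alpha> ^ m * C (Suc i))) at_top"
      unfolding d_eq
      by (intro tendsto_mult[OF tendsto_scaled_tail_product U] indU pos \<alpha> a_pos \<gamma> U_rv Y) auto
    have ev: "\<forall>\<^sub>F t in at_top. scaled_tail \<alpha> (d i (Suc m)) t /
        (t * scaled_tail \<alpha> ?U t * scaled_tail \<alpha> (Y (Suc i)) t) * (scaled_tail \<alpha> ?U t / R (Suc i) t) =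
        scaled_tail \<alpha> (d i (Suc m)) t / R i t"
      using regularly_varyingD(2)[OF U_rv] by eventually_elim (simp add: R_eq)
    \<comment> \<open>The numerator of the Beta value contains \<open>Gamma (a (Suc i))\<close>,
      which cancels the denominator of \<open>C (Suc i)\<close>; its denominator is
      \<open>Gamma (a i)\<close>. Thus the product telescopes.\<close>
    have eq: "\<alpha> * Beta (a (Suc i)) (\<gamma> (Suc i)) * (\<alpha> ^ m * C (Suc i)) = \<alpha> ^ Suc m * C i"
      using Gamma_real_pos[OF a_pos[of "Suc i"]]
      unfolding C_def a_eq split by (simp add: Beta_def)
    show ?thesis using Lim_transform_eventually[OF lim ev] unfolding eq .
  qed
  have "((\<lambda>t. scaled_tail \<alpha> (d i (Suc m)) t / R i t) \<longlongrightarrow> \<alpha> ^ Suc m * C i) at_top"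
    if "i + Suc m = n" for i m
    using that
  proof (induction m arbitrary: i)
    case 0
    then have n: "Suc i = n" by simp
    \<comment> \<open>The innermost bracket is \<open>Z n\<close> alone. Here \<open>R n\<close> is
      its own scaled tail, and \<open>C n\<close> is a quotient of equal Gamma values, namely
      1.\<close>
    have "\<forall>\<^sub>F t in at_top. 1 = scaled_tail \<alpha> (Z n) t / R n t"
      using regularly_varyingD(2)[OF Z] by eventually_elim (simp add: R_def)
    from Lim_transform_eventually[OF tendsto_const this]
    have "((\<lambda>t. scaled_tail \<alpha> (\<lambda>\<omega>. Z (Suc i) \<omega> + d (Suc i) 0 \<omega>) t / R (Suc i) t) \<longlongrightarrow> \<alpha> ^ 0 * C (Suc i)) at_top"
      using Gamma_real_pos[OF \<gamma>s] by (simp add: n d_def C_def a_def)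
    then show ?case by (rule step) (use n in simp)
  next
    case (Suc m)
    have IH: "((\<lambda>t. scaled_tail \<alpha> (d (Suc i) (Suc m)) t / R (Suc i) t) \<longlongrightarrow> \<alpha> ^ Suc m * C (Suc i)) at_top"
      by (rule Suc.IH) (use Suc.prems in simp)
    have d_rv: "regularly_varying (scaled_tail \<alpha> (d (Suc i) (Suc m))) (a (Suc i) - 1)"
      by (rule regularly_varying_equivI[OF _ regularly_varyingD(2)[OF R_rv] regularly_varyingD(3)[OF R_rv] IH])
         (use \<alpha> C_pos indep_var_rv2[OF indZ] in \<open>auto intro!: borel_measurable_scaled_tail\<close>)
    \<comment> \<open>At least one exponent remains in this sum. Its positivity makes the tail of
      the inner sum strictly heavier than that of the summand about to be added.\<close>
    have "0 < sum \<gamma> {Suc (Suc i)..n}" using \<gamma> Suc.prems by (intro sum_pos) auto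
    then have "\<gamma>s - 1 < a (Suc i) - 1" by (simp add: a_def)
    then have "((\<lambda>t. scaled_tail \<alpha> (\<lambda>\<omega>. Z (Suc i) \<omega> + d (Suc i) (Suc m) \<omega>) t / scaled_tail \<alpha> (d (Suc i) (Suc m)) t)
        \<longlongrightarrow> 1) at_top"
      by (intro tendsto_scaled_tail_add[OF indZ \<alpha> d_rv] negl[OF _ _ d_rv]) (use Suc.prems in auto)
    from tendsto_mult[OF this IH]
    have lim: "((\<lambda>t. scaled_tail \<alpha> (\<lambda>\<omega>. Z (Suc i) \<omega> + d (Suc i) (Suc m) \<omega>) t / scaled_tail \<alpha> (d (Suc i) (Suc m)) t *
        (scaled_tail \<alpha> (d (Suc i) (Suc m)) t / R (Suc i) t)) \<longlongrightarrow> \<alpha> ^ Suc m * C (Suc i)) at_top"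
      by simp
    have ev: "\<forall>\<^sub>F t in at_top. scaled_tail \<alpha> (\<lambda>\<omega>. Z (Suc i) \<omega> + d (Suc i) (Suc m) \<omega>) t /
        scaled_tail \<alpha> (d (Suc i) (Suc m)) t * (scaled_tail \<alpha> (d (Suc i) (Suc m)) t / R (Suc i) t) =
        scaled_tail \<alpha> (\<lambda>\<omega>. Z (Suc i) \<omega> + d (Suc i) (Suc m) \<omega>) t / R (Suc i) t"
      using regularly_varyingD(2)[OF d_rv] by eventually_elim simp
    show ?case
      by (rule step[OF Lim_transform_eventually[OF lim ev]]) (use Suc.prems in simp)
  qed
  from this[OF n] show ?thesis
    by (simp only: d_def[abs_def] R_def C_def a_def)
qed

text \<open>L need not be measurable; regular variation in the sense above is only claimed for the tails.\<close>

lemma slowly_varying_powr: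
  assumes L: "slowly_varying L"
  shows "\<forall>\<^sub>F t in at_top. L t * t powr r > 0"
    and "c > 0 \<Longrightarrow> ((\<lambda>t. L (t * c) * (t * c) powr r / (L t * t powr r)) \<longlongrightarrow> c powr r) at_top"
proof -
  show "\<forall>\<^sub>F t in at_top. L t * t powr r > 0"
    using eventually_gt_at_top[of 0]
    by eventually_elim (use L in \<open>auto simp: slowly_varying_def\<close>)
  assume c: "c > 0"
  have "((\<lambda>t. L (t * c) / L t * c powr r) \<longlongrightarrow> 1 * c powr r) at_top"
    using L c by (intro tendsto_intros) (auto simp: slowly_varying_def)
  moreover have "\<forall>\<^sub>F t in at_top. L (t * c) / L t * c powr r = L (t * c) * (t * c) powr r / (L t * t powr r)"
    using eventually_gt_at_top[of 0] by eventually_elim (use c in \<open>simp add: powr_mult\<close>)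
  ultimately show "((\<lambda>t. L (t * c) * (t * c) powr r / (L t * t powr r)) \<longlongrightarrow> c powr r) at_top"
    by (auto intro: Lim_transform_eventually)
qed

text \<open>The substitution x = exp t removes the power of x. The explicit side is eventually
  nonzero, which turns the asymptotic equivalence into a genuine limit of quotients.\<close>

lemma (in prob_space) scaled_tail_asymp:
  fixes U :: "'a \<Rightarrow> real"
  assumes U: "random_variable borel U" and L: "slowly_varying L"
    and asymp: "(\<lambda>x. 1 - cdf (distr M borel U) x) \<sim>[at_top] (\<lambda>x. L (ln x) * ln x powr r * x powr (- \<alpha>))"
  shows "((\<lambda>t. scaled_tail \<alpha> U t / (L t * t powr r)) \<longlongrightarrow> 1) at_top"
    and "regularly_varying (scaled_tail \<alpha> U) r"
proof -
  have "\<forall>\<^sub>F x in at_top. L (ln x) * ln x powr r > 0"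
    by (rule eventually_compose_filterlim[OF slowly_varying_powr(1)[OF L] ln_at_top])
  then have "\<forall>\<^sub>F x in at_top. 1 - cdf (distr M borel U) x \<noteq> 0 \<or> L (ln x) * ln x powr r * x powr (- \<alpha>) \<noteq> 0"
    using eventually_gt_at_top[of 0] by eventually_elim auto
  from filterlim_compose[OF asymp_equivD_strong[OF asymp this] exp_at_top]
  show lim: "((\<lambda>t. scaled_tail \<alpha> U t / (L t * t powr r)) \<longlongrightarrow> 1) at_top"
    by (simp add: scaled_tail_def prob_greater_eq_cdf[OF U] powr_def exp_minus field_simps)
  show "regularly_varying (scaled_tail \<alpha> U) r"
    by (rule regularly_varying_equivI[OF _ slowly_varying_powr[OF L] lim]) (use U in auto)
qed

section \<open>Assembly: the sum, the last summand and the maximum\<close>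

theorem theorem1p1:
  fixes M :: "'a measure"
    and X Y :: "nat \<Rightarrow> 'a \<Rightarrow> real"
    and F G :: "nat \<Rightarrow> real \<Rightarrow> real"
    and \<alpha> \<gamma>s :: real
    and \<gamma> :: "nat \<Rightarrow> real"
    and ls l :: "nat \<Rightarrow> real \<Rightarrow> real"
    and n :: nat
  assumes "prob_space M"
    and "prob_space.indep_vars M (\<lambda>_. borel) X {1..}"
    and "prob_space.indep_vars M (\<lambda>_. borel) Y {1..}"
    and "prob_space.independent_sequences M X Y"
    and "\<And>i. i \<ge> 1 \<Longrightarrow> AE \<omega> in M. Y i \<omega> > 0"
    and "\<And>i. i \<ge> 1 \<Longrightarrow> F i = cdf (distr M borel (X i))"
    and "\<And>i. i \<ge> 1 \<Longrightarrow> G i = cdf (distr M borel (Y i))"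
    and "\<alpha> > 0" and "\<gamma>s > 0"
    and "\<And>i. i \<ge> 1 \<Longrightarrow> \<gamma> i > 0"
    and "\<And>i. i \<ge> 1 \<Longrightarrow> slowly_varying (ls i)"
    and "\<And>i. i \<ge> 1 \<Longrightarrow> slowly_varying (l i)"
    and "\<And>i. i \<ge> 1 \<Longrightarrow> (\<lambda>x. 1 - F i x) \<sim>[at_top]
           (\<lambda>x. ls i (ln x) * ln x powr (\<gamma>s - 1) * x powr (- \<alpha>))"
    and "\<And>i. i \<ge> 1 \<Longrightarrow> (\<lambda>x. 1 - G i x) \<sim>[at_top]
           (\<lambda>x. l i (ln x) * ln x powr (\<gamma> i - 1) * x powr (- \<alpha>))"
    and "n \<ge> 1"
  shows "(\<lambda>x. \<P>(\<omega> in M. partial_sum X Y n \<omega> > x)) \<sim>[at_top]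
           (\<lambda>x. \<P>(\<omega> in M. partial_max X Y n \<omega> > x)) \<and>
         (\<lambda>x. \<P>(\<omega> in M. partial_max X Y n \<omega> > x)) \<sim>[at_top]
           (\<lambda>x. \<P>(\<omega> in M. X n \<omega> * (\<Prod>j=1..n. Y j \<omega>) > x)) \<and>
         (\<lambda>x. \<P>(\<omega> in M. X n \<omega> * (\<Prod>j=1..n. Y j \<omega>) > x)) \<sim>[at_top]
           (\<lambda>x. \<alpha> ^ n * Gamma \<gamma>s * (\<Prod>i=1..n. Gamma (\<gamma> i)) / Gamma (\<gamma>s + (\<Sum>i=1..n. \<gamma> i))
                * ls n (ln x) * (\<Prod>i=1..n. l i (ln x))
                * ln x powr (\<gamma>s + (\<Sum>i=1..n. \<gamma> i) - 1) * x powr (- \<alpha>))"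
proof -
  interpret prob_space M by fact
  note \<alpha> = \<open>\<alpha> > 0\<close> and \<gamma>s = \<open>\<gamma>s > 0\<close> and \<gamma> = assms(10) and n = \<open>n \<ge> 1\<close>
  have X_rv: "random_variable borel (X i)" and Y_rv: "random_variable borel (Y i)" if "i \<ge> 1" for i
    using assms(2,3) that by (auto simp: indep_vars_def2)
  have joint: "indep_vars (\<lambda>_. borel) (case_sum X Y) ({1..} <+> {1..})"
    using assms(4) by (intro indep_vars_joint assms(2,3)) (simp add: independent_sequences_def)
  have X_asymp: "(\<lambda>x. 1 - cdf (distr M borel (X i)) x) \<sim>[at_top]
      (\<lambda>x. ls i (ln x) * ln x powr (\<gamma>s - 1) * x powr (- \<alpha>))" if "i \<ge> 1" for i
    using assms(13)[OF that] by (simp add: assms(6)[OF that])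
  have Y_asymp: "(\<lambda>x. 1 - cdf (distr M borel (Y i)) x) \<sim>[at_top]
      (\<lambda>x. l i (ln x) * ln x powr (\<gamma> i - 1) * x powr (- \<alpha>))" if "i \<ge> 1" for i
    using assms(14)[OF that] by (simp add: assms(7)[OF that])
  note X_tail = scaled_tail_asymp[OF X_rv assms(11) X_asymp]
  note Y_tail = scaled_tail_asymp[OF Y_rv assms(12) Y_asymp]
  \<comment> \<open>The target \<open>T\<close> is split at \<open>x = exp t\<close> into the
    constant \<open>\<kappa>\<close>, the function \<open>S t\<close> and the exponential. The
    factors of \<open>S\<close> are grouped so that each \<open>Y j\<close> contributes
    \<open>t * (l j t * t powr (\<gamma> j - 1))\<close>.\<close>
  define \<kappa> where "\<kappa> = \<alpha> ^ n * (Gamma \<gamma>s * (\<Prod>i=1..n. Gamma (\<gamma> i)) / Gamma (\<gamma>s + (\<Sum>i=1..n. \<gamma> i)))"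
  define S where "S t = (\<Prod>i=1..n. l i t) * t powr (\<Sum>i=1..n. \<gamma> i) * (ls n t * t powr (\<gamma>s - 1))" for t
  define T where "T x = \<alpha> ^ n * Gamma \<gamma>s * (\<Prod>i=1..n. Gamma (\<gamma> i)) / Gamma (\<gamma>s + (\<Sum>i=1..n. \<gamma> i))
      * ls n (ln x) * (\<Prod>i=1..n. l i (ln x)) * ln x powr (\<gamma>s + (\<Sum>i=1..n. \<gamma> i) - 1) * x powr (- \<alpha>)" for x
  have \<kappa>: "\<kappa> > 0"
    unfolding \<kappa>_def using \<alpha> \<gamma>s \<gamma>
    by (intro mult_pos_pos divide_pos_pos prod_pos Gamma_real_pos zero_less_power add_pos_nonneg sum_nonneg)
       (auto intro: less_imp_le)
  have S_pos: "S t > 0" if "t > 0" for t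
    unfolding S_def using that assms(11)[OF n] assms(12)
    by (intro mult_pos_pos prod_pos) (auto simp: slowly_varying_def)
  have T_eq: "T x = \<kappa> * S (ln x) * exp (- \<alpha> * ln x)" if "x > 0" for x
  proof -
    have "\<gamma>s + (\<Sum>i=1..n. \<gamma> i) - 1 = (\<Sum>i=1..n. \<gamma> i) + (\<gamma>s - 1)" by simp
    then show ?thesis
      using that unfolding T_def \<kappa>_def S_def powr_def[of x] by (simp only: powr_add) (simp add: mult_ac)
  qed
  have T_pos: "\<forall>\<^sub>F x in at_top. T x > 0"
    using eventually_gt_at_top[of 1]
    by eventually_elim (simp add: T_eq \<kappa> S_pos)
  define D where "D \<phi> \<omega> = discounted_sum (\<lambda>j. \<phi> j (X j \<omega>)) (\<lambda>j. Y j \<omega>) 0 n"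
    for \<phi> :: "nat \<Rightarrow> real \<Rightarrow> real" and \<omega>
  \<comment> \<open>Instances of \<open>\<phi>\<close>: the identity for \<open>S_n\<close>, the positive part for the bound on \<open>M_n\<close>, and the selector of index n for the last summand.\<close>
  have key: "((\<lambda>x. \<P>(\<omega> in M. D \<phi> \<omega> > x) / T x) \<longlongrightarrow> 1) at_top"
    if \<phi>: "\<And>i. \<phi> i \<in> borel_measurable borel"
      and top: "scaled_tail \<alpha> (\<lambda>\<omega>. \<phi> n (X n \<omega>)) = scaled_tail \<alpha> (X n)"
      and le: "\<And>i t. 1 \<le> i \<Longrightarrow> scaled_tail \<alpha> (\<lambda>\<omega>. \<phi> i (X i \<omega>)) t \<le> scaled_tail \<alpha> (X i) t"
    for \<phi> :: "nat \<Rightarrow> real \<Rightarrow> real"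
  proof -
    have "indep_vars (\<lambda>_. borel) (\<lambda>k \<omega>. case_sum \<phi> (\<lambda>_ y. y) k (case_sum X Y k \<omega>)) ({1..} <+> {1..})"
      by (rule indep_vars_compose2[OF joint]) (use \<phi> in auto)
    also have "(\<lambda>k \<omega>. case_sum \<phi> (\<lambda>_ y. y) k (case_sum X Y k \<omega>)) = case_sum (\<lambda>i \<omega>. \<phi> i (X i \<omega>)) Y"
      by (auto simp: fun_eq_iff split: sum.split)
    finally have ind: "indep_vars (\<lambda>_. borel) (case_sum (\<lambda>i \<omega>. \<phi> i (X i \<omega>)) Y) ({1..} <+> {1..})" .
    have negl: "((\<lambda>t. scaled_tail \<alpha> (\<lambda>\<omega>. \<phi> i (X i \<omega>)) t / f t) \<longlongrightarrow> 0) at_top"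
      if i: "1 \<le> i" and f: "regularly_varying f r" "\<gamma>s - 1 < r" for i f r
    proof (rule tendsto_sandwich[OF _ _ tendsto_const])
      show "((\<lambda>t. scaled_tail \<alpha> (X i) t / f t) \<longlongrightarrow> 0) at_top"
        by (rule regularly_varying_ratio_tendsto_0[OF X_tail(2)[OF i i i] f])
      show "\<forall>\<^sub>F t in at_top. 0 \<le> scaled_tail \<alpha> (\<lambda>\<omega>. \<phi> i (X i \<omega>)) t / f t"
        using regularly_varyingD(2)[OF f(1)] by eventually_elim (simp add: scaled_tail_nonneg)
      show "\<forall>\<^sub>F t in at_top. scaled_tail \<alpha> (\<lambda>\<omega>. \<phi> i (X i \<omega>)) t / f t \<le> scaled_tail \<alpha> (X i) t / f t"
        using regularly_varyingD(2)[OF f(1)] by eventually_elim (simp add: le[OF i] divide_right_mono)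
    qed
    define R where "R t = scaled_tail \<alpha> (X n) t * (\<Prod>j=1..n. t * scaled_tail \<alpha> (Y j) t)" for t
    \<comment> \<open>The full sum starts from offset 0, and its \<open>n\<close> summands are
      written as \<open>Suc (n - 1)\<close>.\<close>
    have lim1: "((\<lambda>t. scaled_tail \<alpha> (D \<phi>) t / R t) \<longlongrightarrow> \<kappa>) at_top"
      using tendsto_scaled_tail_discounted_sum[OF ind assms(5) \<alpha> \<gamma>s \<gamma> Y_tail(2), of n 0 "n - 1"]
        X_tail(2)[OF n n n] negl n
      by (simp add: D_def[abs_def] R_def \<kappa>_def top)
    \<comment> \<open>The limit so far is expressed in the actual tails; the tail hypotheses
      exchange each of them for its explicit equivalent, which turns \<open>R\<close> into
      \<open>S\<close>.\<close>
    have "((\<lambda>t. scaled_tail \<alpha> (X n) t / (ls n t * t powr (\<gamma>s - 1)) *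
        (\<Prod>j=1..n. scaled_tail \<alpha> (Y j) t / (l j t * t powr (\<gamma> j - 1)))) \<longlongrightarrow> 1 * (\<Prod>j=1..n. 1)) at_top"
      by (intro tendsto_mult tendsto_prod X_tail(1) Y_tail(1) n) auto
    from tendsto_mult[OF lim1 this]
    have lim: "((\<lambda>t. scaled_tail \<alpha> (D \<phi>) t / R t * (scaled_tail \<alpha> (X n) t / (ls n t * t powr (\<gamma>s - 1)) *
        (\<Prod>j=1..n. scaled_tail \<alpha> (Y j) t / (l j t * t powr (\<gamma> j - 1))))) \<longlongrightarrow> \<kappa>) at_top"
      by simp
    have R_pos: "\<forall>\<^sub>F t in at_top. \<forall>j\<in>{1..n}. scaled_tail \<alpha> (Y j) t > 0"
      using Y_tail(2)[THEN regularly_varyingD(2)] by (intro eventually_ball_finite) auto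
    have "\<forall>\<^sub>F t in at_top. scaled_tail \<alpha> (D \<phi>) t / R t * (scaled_tail \<alpha> (X n) t / (ls n t * t powr (\<gamma>s - 1)) *
        (\<Prod>j=1..n. scaled_tail \<alpha> (Y j) t / (l j t * t powr (\<gamma> j - 1)))) = scaled_tail \<alpha> (D \<phi>) t / S t"
      using R_pos regularly_varyingD(2)[OF X_tail(2)[OF n n n]] eventually_gt_at_top[of 0]
    proof eventually_elim
      case (elim t)
      have "(\<Prod>j=1..n. t * (l j t * t powr (\<gamma> j - 1))) = (\<Prod>j=1..n. l j t * t powr \<gamma> j)"
        using elim by (intro prod.cong refl) (simp add: powr_diff)
      also have "\<dots> = (\<Prod>i=1..n. l i t) * t powr (\<Sum>i=1..n. \<gamma> i)"
        using elim by (subst prod.distrib) (simp only: powr_sum)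
      finally have S_eq: "S t = (\<Prod>j=1..n. t * (l j t * t powr (\<gamma> j - 1))) * (ls n t * t powr (\<gamma>s - 1))"
        by (simp only: S_def)
      have "(\<Prod>j=1..n. scaled_tail \<alpha> (Y j) t / (l j t * t powr (\<gamma> j - 1))) =
          (\<Prod>j=1..n. t * scaled_tail \<alpha> (Y j) t / (t * (l j t * t powr (\<gamma> j - 1))))"
        using elim by (intro prod.cong refl) simp
      also have "\<dots> = (\<Prod>j=1..n. t * scaled_tail \<alpha> (Y j) t) / (\<Prod>j=1..n. t * (l j t * t powr (\<gamma> j - 1)))"
        by (rule prod_dividef)
      finally have quot: "(\<Prod>j=1..n. scaled_tail \<alpha> (Y j) t / (l j t * t powr (\<gamma> j - 1))) = \<dots>" .
      have cancel: "p / (a * c) * (a / b * (c / d)) = p / (d * b)" if "a \<noteq> 0" "c \<noteq> 0" for a b c d p :: real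
        using that by simp
      have "(\<Prod>j=1..n. t * scaled_tail \<alpha> (Y j) t) > 0"
        using elim by (intro prod_pos) auto
      with elim show ?case
        unfolding R_def S_eq quot by (intro cancel) auto
    qed
    from Lim_transform_eventually[OF lim this]
    have "((\<lambda>t. scaled_tail \<alpha> (D \<phi>) t / S t / \<kappa>) \<longlongrightarrow> \<kappa> / \<kappa>) at_top"
      using \<kappa> by (intro tendsto_divide tendsto_const) auto
    from filterlim_compose[OF this ln_at_top]
    have lim: "((\<lambda>x. scaled_tail \<alpha> (D \<phi>) (ln x) / S (ln x) / \<kappa>) \<longlongrightarrow> 1) at_top"
      using \<kappa> by simp
    have "\<forall>\<^sub>F x in at_top. scaled_tail \<alpha> (D \<phi>) (ln x) / S (ln x) / \<kappa> = \<P>(\<omega> in M. D \<phi> \<omega> > x) / T x"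
      using eventually_gt_at_top[of 0]
      by eventually_elim (simp add: T_eq scaled_tail_def exp_minus field_simps)
    from Lim_transform_eventually[OF lim this] show ?thesis .
  qed
  \<comment> \<open>A scaled tail sees a variable only above the positive levels
    \<open>exp t\<close>, so cutting \<open>X i\<close> off at 0 leaves it unchanged.\<close>
  have tail_eqI: "scaled_tail \<alpha> U = scaled_tail \<alpha> V" if "\<And>\<omega> x. x > 0 \<Longrightarrow> U \<omega> > x \<longleftrightarrow> V \<omega> > x" for U V
    using that by (simp add: scaled_tail_def fun_eq_iff)
  have S_lim: "((\<lambda>x. \<P>(\<omega> in M. partial_sum X Y n \<omega> > x) / T x) \<longlongrightarrow> 1) at_top"
    using key[of "\<lambda>_ y. y"] by (simp add: D_def discounted_sum_eq partial_sum_def)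
  have pos_lim: "((\<lambda>x. \<P>(\<omega> in M. D (\<lambda>_ y. max y 0) \<omega> > x) / T x) \<longlongrightarrow> 1) at_top"
  proof (rule key)
    have eq: "scaled_tail \<alpha> (\<lambda>\<omega>. max (X i \<omega>) 0) = scaled_tail \<alpha> (X i)" for i
      by (rule tail_eqI) auto
    show "scaled_tail \<alpha> (\<lambda>\<omega>. max (X n \<omega>) 0) = scaled_tail \<alpha> (X n)" by (rule eq)
    show "scaled_tail \<alpha> (\<lambda>\<omega>. max (X i \<omega>) 0) t \<le> scaled_tail \<alpha> (X i) t" for i t by (simp only: eq)
  qed measurable
  have last_lim: "((\<lambda>x. \<P>(\<omega> in M. X n \<omega> * (\<Prod>j=1..n. Y j \<omega>) > x) / T x) \<longlongrightarrow> 1) at_top"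
  proof -
    have "D (\<lambda>i y. if i = n then y else 0) \<omega> = X n \<omega> * (\<Prod>j=1..n. Y j \<omega>)" for \<omega>
      using n by (simp add: D_def discounted_sum_eq if_distrib[of "\<lambda>x. x * _"] cong: if_cong)
    moreover have "scaled_tail \<alpha> (\<lambda>\<omega>. if i = n then X i \<omega> else 0) t \<le> scaled_tail \<alpha> (X i) t" for i t
      by (cases "i = n") (simp_all add: scaled_tail_def)
    ultimately show ?thesis
      using key[of "\<lambda>i y. if i = n then y else 0"] by simp
  qed
  \<comment> \<open>\<open>S_n\<close> is one of the values in the maximum, which gives the lower
    bound; the sum formed with positive parts bounds all of them almost surely.\<close>
  have M_lim: "((\<lambda>x. \<P>(\<omega> in M. partial_max X Y n \<omega> > x) / T x) \<longlongrightarrow> 1) at_top"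
  proof (rule tendsto_sandwich[OF _ _ S_lim pos_lim])
    have ps_rv [measurable]: "random_variable borel (partial_sum X Y k)" for k
      unfolding partial_sum_def[abs_def] using X_rv Y_rv
      by (intro borel_measurable_sum borel_measurable_times borel_measurable_prod) auto
    have D_rv [measurable]: "random_variable borel (D (\<lambda>_ y. max y 0))"
      unfolding D_def[abs_def] discounted_sum_eq using X_rv Y_rv
      by (intro borel_measurable_sum borel_measurable_times borel_measurable_prod borel_measurable_max) auto
    have max_iff: "partial_max X Y n \<omega> > x \<longleftrightarrow> (\<exists>k\<in>{0..n}. partial_sum X Y k \<omega> > x)" for x \<omega>
      unfolding partial_max_def by (subst Max_gr_iff) auto
    have max_meas: "{\<omega>\<in>space M. partial_max X Y n \<omega> > x} \<in> events" for x
      unfolding max_iff by measurable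
    show "\<forall>\<^sub>F x in at_top. \<P>(\<omega> in M. partial_sum X Y n \<omega> > x) / T x \<le> \<P>(\<omega> in M. partial_max X Y n \<omega> > x) / T x"
      using T_pos
    proof eventually_elim
      case (elim x)
      have "\<P>(\<omega> in M. partial_sum X Y n \<omega> > x) \<le> \<P>(\<omega> in M. partial_max X Y n \<omega> > x)"
        by (rule finite_measure_mono[OF _ max_meas]) (auto simp: max_iff)
      then show ?case using elim by (intro divide_right_mono) auto
    qed
    have "AE \<omega> in M. \<forall>i\<in>{1..}. Y i \<omega> > 0"
      using assms(5) by (intro AE_ball_countable[THEN iffD2]) auto
    \<comment> \<open>With positive parts and positive \<open>Y\<close> all summands are
      nonnegative, so extending the sum from \<open>k\<close> to \<open>n\<close> can only increase
      it. The value 0 at \<open>k = 0\<close> is covered as well.\<close>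
    then have dom: "AE \<omega> in M. \<forall>k\<in>{0..n}. partial_sum X Y k \<omega> \<le> D (\<lambda>_ y. max y 0) \<omega>"
    proof eventually_elim
      case (elim \<omega>)
      show ?case
      proof
        fix k assume k: "k \<in> {0..n}"
        have prod_nonneg: "0 \<le> (\<Prod>j=1..i. Y j \<omega>)" for i
          using elim by (intro prod_nonneg) (auto intro: less_imp_le)
        have "partial_sum X Y k \<omega> \<le> (\<Sum>i=1..k. max (X i \<omega>) 0 * (\<Prod>j=1..i. Y j \<omega>))"
          unfolding partial_sum_def by (intro sum_mono mult_right_mono prod_nonneg) auto
        also have "\<dots> \<le> (\<Sum>i=1..n. max (X i \<omega>) 0 * (\<Prod>j=1..i. Y j \<omega>))"
          using k by (intro sum_mono2 mult_nonneg_nonneg prod_nonneg) auto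
        finally show "partial_sum X Y k \<omega> \<le> D (\<lambda>_ y. max y 0) \<omega>"
          by (simp add: D_def discounted_sum_eq)
      qed
    qed
    show "\<forall>\<^sub>F x in at_top. \<P>(\<omega> in M. partial_max X Y n \<omega> > x) / T x \<le> \<P>(\<omega> in M. D (\<lambda>_ y. max y 0) \<omega> > x) / T x"
      using T_pos
    proof eventually_elim
      case (elim x)
      have "\<P>(\<omega> in M. partial_max X Y n \<omega> > x) \<le> \<P>(\<omega> in M. D (\<lambda>_ y. max y 0) \<omega> > x)"
      proof (rule finite_measure_mono_AE)
        show "AE \<omega> in M. \<omega> \<in> {\<omega>\<in>space M. partial_max X Y n \<omega> > x} \<longrightarrow>
            \<omega> \<in> {\<omega>\<in>space M. D (\<lambda>_ y. max y 0) \<omega> > x}"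
          using dom by eventually_elim (auto simp: max_iff intro: less_le_trans)
      qed measurable
      then show ?case using elim by (intro divide_right_mono) auto
    qed
  qed
  note asymp = S_lim[THEN asymp_equivI'] M_lim[THEN asymp_equivI'] last_lim[THEN asymp_equivI']
  show ?thesis
    by (rule conjI[OF asymp_equiv_trans[OF asymp(1) asymp_equiv_symI[OF asymp(2)]]
          conjI[OF asymp_equiv_trans[OF asymp(2) asymp_equiv_symI[OF asymp(3)]] asymp(3)[unfolded T_def]]])
qed

end
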